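(* There exist no geodesic Legendre null curves in a 3-dimensional Sasaki-like almost contact B-metric manifold $(M,\varphi,\xi,\eta,g)$.
   Context: A 3-dimensional almost contact B-metric manifold $(M,\varphi,\xi,\eta,g)$ is a smooth 3-manifold with an endomorphism $\varphi$ of $TM$, a vector field $\xi$, a 1-form $\eta$ and a pseudo-Riemannian metric $g$ (necessarily of signature $(+,+,-)$) such that $\varphi^2X=-X+\eta(X)\xi$, $\eta(\xi)=1$, $g(\varphi X,\varphi Y)=-g(X,Y)+\eta(X)\eta(Y)$. Consequences: $\eta\circ\varphi=0$, $\varphi\xi=0$, $\eta(X)=g(X,\xi)$. With $\nabla$ the Levi-Civita connection of $g$, it is Sasaki-like if $(\nabla_X\varphi)Y=-g(X,Y)\xi-\eta(Y)X+2\eta(X)\eta(Y)\xi$ (then $\nabla_X\xi=-\varphi X$). A smooth curve $C:I\to M$ ($I$ an interval) is null if $g(\dot C,\dot C)=0$ and $\dot C\neq 0$ on $I$; it is Legendre if $\eta(\dot C)=0$. For a null curve with a general Frenet frame $\{\dot C,N,W\}$ ($g(\dot C,N)=g(W,W)=1$, $g(N,N)=g(N,W)=g(\dot C,W)=0$) one has $\nabla_{\dot C}\dot C=h\dot C+k_1W$; the null curve is called geodesic if $k_1$ vanishes identically, i.e. $\nabla_{\dot C}\dot C$ is everywhere proportional to $\dot C$ (a geodesic up to reparameterization). *)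

theory Defs
  imports "HOL-Analysis.Analysis"
begin

section \<open>Smooth maps and smooth 3-manifolds\<close>

text \<open>
  For open \<open>S\<close> in a Euclidean space, \<open>Ck_on k S f\<close> says that \<open>f\<close> is \<open>k\<close> times continuously
  differentiable on \<open>S\<close>, expressed by iterated directional derivatives in constant directions.
\<close>

primrec Ck_on :: "nat \<Rightarrow> 'a::euclidean_space set \<Rightarrow> ('a \<Rightarrow> 'b::real_normed_vector) \<Rightarrow> bool" where
  "Ck_on 0 S f \<longleftrightarrow> continuous_on S f"
| "Ck_on (Suc k) S f \<longleftrightarrow>
     (\<forall>x\<in>S. f differentiable (at x)) \<and> (\<forall>v. Ck_on k S (\<lambda>x. frechet_derivative f (at x) v))"

definition smooth_on :: "'a::euclidean_space set \<Rightarrow> ('a \<Rightarrow> 'b::real_normed_vector) \<Rightarrow> bool" where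
  "smooth_on S f \<longleftrightarrow> (\<forall>k. Ck_on k S f)"

text \<open>A chart is a pair of a domain and a coordinate map; only the values on the domain matter.\<close>

type_synonym 'p chart = "'p set \<times> ('p \<Rightarrow> real^3)"

definition is_chart :: "'p::topological_space chart \<Rightarrow> bool" where
  "is_chart c \<longleftrightarrow> open (fst c) \<and> open (snd c ` fst c) \<and> (\<exists>y. homeomorphism (fst c) (snd c ` fst c) (snd c) y)"

abbreviation chart_inv :: "'p chart \<Rightarrow> real^3 \<Rightarrow> 'p" where
  "chart_inv c \<equiv> inv_into (fst c) (snd c)"

abbreviation chart_image :: "'p chart \<Rightarrow> 'p set \<Rightarrow> (real^3) set" where
  "chart_image c U \<equiv> snd c ` (U \<inter> fst c)"

text \<open>\<open>A\<close> is a smooth atlas (not necessarily maximal) of dimension 3 on the whole space \<open>'p\<close>.\<close>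

definition smooth_manifold3 :: "'p::{t2_space,second_countable_topology} chart set \<Rightarrow> bool" where
  "smooth_manifold3 A \<longleftrightarrow>
     (\<forall>c\<in>A. is_chart c) \<and> (\<Union>c\<in>A. fst c) = UNIV \<and>
     (\<forall>c\<in>A. \<forall>d\<in>A. smooth_on (chart_image c (fst d)) (snd d \<circ> chart_inv c))"

definition smooth_function :: "'p chart set \<Rightarrow> 'p set \<Rightarrow> ('p \<Rightarrow> real) \<Rightarrow> bool" where
  "smooth_function A U f \<longleftrightarrow> (\<forall>c\<in>A. smooth_on (chart_image c U) (f \<circ> chart_inv c))"


section \<open>Tangent vectors and vector fields\<close>

text \<open>
  A tangent vector at \<open>p\<close> is given by its components in all charts around \<open>p\<close>, related by the
  Jacobians of the coordinate changes. The components in charts not around \<open>p\<close> are set to \<open>0\<close>,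
  so that equality of elements of \<open>tangent_space A p\<close> is equality of tangent vectors.
\<close>

typedef 'p tvec = "UNIV :: ('p chart \<Rightarrow> real^3) set"
  morphisms component Tvec
  by simp

lemma component_Tvec [simp]: "component (Tvec v) c = v c"
  by (simp add: Tvec_inverse)

lemma tvec_eq_iff: "v = w \<longleftrightarrow> (\<forall>c. component v c = component w c)"
  by (metis component_inject ext)

instantiation tvec :: (type) real_vector
begin

definition "0 = Tvec (\<lambda>c. 0)"
definition "v + w = Tvec (\<lambda>c. component v c + component w c)"
definition "v - w = Tvec (\<lambda>c. component v c - component w c)"
definition "- v = Tvec (\<lambda>c. - component v c)"
definition "a *\<^sub>R v = Tvec (\<lambda>c. a *\<^sub>R component v c)"

instance
  by standard
    (simp_all add: tvec_eq_iff zero_tvec_def plus_tvec_def minus_tvec_def uminus_tvec_def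
      scaleR_tvec_def algebra_simps)

end

definition tangent_space :: "'p chart set \<Rightarrow> 'p \<Rightarrow> 'p tvec set" where
  "tangent_space A p = {v.
     (\<forall>c\<in>A. \<forall>d\<in>A. p \<in> fst c \<inter> fst d \<longrightarrow>
        component v d = frechet_derivative (snd d \<circ> chart_inv c) (at (snd c p)) (component v c)) \<and>
     (\<forall>c. \<not> (c \<in> A \<and> p \<in> fst c) \<longrightarrow> component v c = 0)}"

text \<open>
  Vector fields are total functions, but all conditions on them concern an open set \<open>U\<close> only;
  their values off \<open>U\<close> are irrelevant.
\<close>

type_synonym 'p vfield = "'p \<Rightarrow> 'p tvec"

definition smooth_vfield :: "'p chart set \<Rightarrow> 'p set \<Rightarrow> 'p vfield \<Rightarrow> bool" where
  "smooth_vfield A U X \<longleftrightarrow>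
     (\<forall>p\<in>U. X p \<in> tangent_space A p) \<and>
     (\<forall>c\<in>A. smooth_on (chart_image c U) (\<lambda>z. component (X (chart_inv c z)) c))"

definition chart_at :: "'p chart set \<Rightarrow> 'p \<Rightarrow> 'p chart" where
  "chart_at A p = (SOME c. c \<in> A \<and> p \<in> fst c)"

text \<open>The derivative \<open>X\<^sub>p f\<close>; it does not depend on the chart around \<open>p\<close>.\<close>

definition dir_deriv :: "'p chart set \<Rightarrow> 'p vfield \<Rightarrow> ('p \<Rightarrow> real) \<Rightarrow> 'p \<Rightarrow> real" where
  "dir_deriv A X f p =
     (let c = chart_at A p in frechet_derivative (f \<circ> chart_inv c) (at (snd c p)) (component (X p) c))"

definition lie_bracket :: "'p chart set \<Rightarrow> 'p vfield \<Rightarrow> 'p vfield \<Rightarrow> 'p vfield" where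
  "lie_bracket A X Y p = Tvec (\<lambda>c. if c \<in> A \<and> p \<in> fst c then
      frechet_derivative (\<lambda>z. component (Y (chart_inv c z)) c) (at (snd c p)) (component (X p) c)
    - frechet_derivative (\<lambda>z. component (X (chart_inv c z)) c) (at (snd c p)) (component (Y p) c)
    else 0)"

text \<open>The coordinate vector field \<open>\<partial>\<^sub>i\<close> of the chart \<open>c\<close>, on the domain of \<open>c\<close>.\<close>

definition coord_field :: "'p chart set \<Rightarrow> 'p chart \<Rightarrow> 3 \<Rightarrow> 'p vfield" where
  "coord_field A c i p = Tvec (\<lambda>d. if d \<in> A \<and> p \<in> fst d then
      frechet_derivative (snd d \<circ> chart_inv c) (at (snd c p)) (axis i 1) else 0)"


section \<open>Tensor fields\<close>

text \<open>Smoothness of a tensor field: it maps smooth (local) vector fields to smooth objects.\<close>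

definition linear_on_space :: "'a::real_vector set \<Rightarrow> ('a \<Rightarrow> 'b::real_vector) \<Rightarrow> bool" where
  "linear_on_space V f \<longleftrightarrow>
     (\<forall>v\<in>V. \<forall>w\<in>V. f (v + w) = f v + f w) \<and> (\<forall>a. \<forall>v\<in>V. f (a *\<^sub>R v) = a *\<^sub>R f v)"

definition one_form :: "'p::topological_space chart set \<Rightarrow> ('p \<Rightarrow> 'p tvec \<Rightarrow> real) \<Rightarrow> bool" where
  "one_form A \<eta> \<longleftrightarrow>
     (\<forall>p. linear_on_space (tangent_space A p) (\<eta> p)) \<and>
     (\<forall>U X. open U \<and> smooth_vfield A U X \<longrightarrow> smooth_function A U (\<lambda>p. \<eta> p (X p)))"

definition endomorphism_field ::
    "'p::topological_space chart set \<Rightarrow> ('p \<Rightarrow> 'p tvec \<Rightarrow> 'p tvec) \<Rightarrow> bool" where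
  "endomorphism_field A \<phi> \<longleftrightarrow>
     (\<forall>p. \<phi> p ` tangent_space A p \<subseteq> tangent_space A p \<and> linear_on_space (tangent_space A p) (\<phi> p)) \<and>
     (\<forall>U X. open U \<and> smooth_vfield A U X \<longrightarrow> smooth_vfield A U (\<lambda>p. \<phi> p (X p)))"

definition pseudo_riemannian_metric ::
    "'p::topological_space chart set \<Rightarrow> ('p \<Rightarrow> 'p tvec \<Rightarrow> 'p tvec \<Rightarrow> real) \<Rightarrow> bool" where
  "pseudo_riemannian_metric A g \<longleftrightarrow>
     (\<forall>p. (\<forall>v\<in>tangent_space A p. linear_on_space (tangent_space A p) (\<lambda>w. g p v w) \<and>
                                    linear_on_space (tangent_space A p) (\<lambda>w. g p w v)) \<and>
          (\<forall>v\<in>tangent_space A p. \<forall>w\<in>tangent_space A p. g p v w = g p w v) \<and>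
          (\<forall>v\<in>tangent_space A p. (\<forall>w\<in>tangent_space A p. g p v w = 0) \<longrightarrow> v = 0)) \<and>
     (\<forall>U X Y. open U \<and> smooth_vfield A U X \<and> smooth_vfield A U Y \<longrightarrow>
        smooth_function A U (\<lambda>p. g p (X p) (Y p)))"

text \<open>
  The signature \<open>(+,+,-)\<close> of \<open>g\<close> is a consequence of these conditions and is therefore not listed.
\<close>

definition almost_contact_B_metric ::
    "'p::{t2_space,second_countable_topology} chart set \<Rightarrow> ('p \<Rightarrow> 'p tvec \<Rightarrow> 'p tvec) \<Rightarrow> 'p vfield \<Rightarrow>
     ('p \<Rightarrow> 'p tvec \<Rightarrow> real) \<Rightarrow> ('p \<Rightarrow> 'p tvec \<Rightarrow> 'p tvec \<Rightarrow> real) \<Rightarrow> bool" where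
  "almost_contact_B_metric A \<phi> \<xi> \<eta> g \<longleftrightarrow>
     smooth_manifold3 A \<and> endomorphism_field A \<phi> \<and> smooth_vfield A UNIV \<xi> \<and> one_form A \<eta> \<and>
     pseudo_riemannian_metric A g \<and>
     (\<forall>p. \<forall>X\<in>tangent_space A p. \<phi> p (\<phi> p X) = - X + \<eta> p X *\<^sub>R \<xi> p) \<and>
     (\<forall>p. \<eta> p (\<xi> p) = 1) \<and>
     (\<forall>p. \<forall>X\<in>tangent_space A p. \<forall>Y\<in>tangent_space A p.
        g p (\<phi> p X) (\<phi> p Y) = - g p X Y + \<eta> p X * \<eta> p Y)"


section \<open>The Levi-Civita connection\<close>

text \<open>
  A connection acts on vector fields defined on arbitrary open sets. Every connection given on
  global vector fields extends uniquely to local ones. Locality in the second argument, that is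
  \<open>\<nabla>\<^sub>X Y = \<nabla>\<^sub>X Y'\<close> on \<open>U\<close> whenever \<open>Y = Y'\<close> on \<open>U\<close>, and likewise in the first, is contained in
  the axioms because functions and fields are unconstrained off \<open>U\<close>.
\<close>

definition affine_connection ::
    "'p::topological_space chart set \<Rightarrow> ('p vfield \<Rightarrow> 'p vfield \<Rightarrow> 'p vfield) \<Rightarrow> bool" where
  "affine_connection A nabla \<longleftrightarrow> (\<forall>U. open U \<longrightarrow>
     (\<forall>X Y. smooth_vfield A U X \<and> smooth_vfield A U Y \<longrightarrow> smooth_vfield A U (nabla X Y)) \<and>
     (\<forall>X X' Y. smooth_vfield A U X \<and> smooth_vfield A U X' \<and> smooth_vfield A U Y \<longrightarrow>
        (\<forall>p\<in>U. nabla (\<lambda>q. X q + X' q) Y p = nabla X Y p + nabla X' Y p)) \<and>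
     (\<forall>f X Y. smooth_function A U f \<and> smooth_vfield A U X \<and> smooth_vfield A U Y \<longrightarrow>
        (\<forall>p\<in>U. nabla (\<lambda>q. f q *\<^sub>R X q) Y p = f p *\<^sub>R nabla X Y p)) \<and>
     (\<forall>X Y Y'. smooth_vfield A U X \<and> smooth_vfield A U Y \<and> smooth_vfield A U Y' \<longrightarrow>
        (\<forall>p\<in>U. nabla X (\<lambda>q. Y q + Y' q) p = nabla X Y p + nabla X Y' p)) \<and>
     (\<forall>f X Y. smooth_function A U f \<and> smooth_vfield A U X \<and> smooth_vfield A U Y \<longrightarrow>
        (\<forall>p\<in>U. nabla X (\<lambda>q. f q *\<^sub>R Y q) p = dir_deriv A X f p *\<^sub>R Y p + f p *\<^sub>R nabla X Y p)))"

definition torsion_free ::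
    "'p::topological_space chart set \<Rightarrow> ('p vfield \<Rightarrow> 'p vfield \<Rightarrow> 'p vfield) \<Rightarrow> bool" where
  "torsion_free A nabla \<longleftrightarrow> (\<forall>U X Y. open U \<and> smooth_vfield A U X \<and> smooth_vfield A U Y \<longrightarrow>
     (\<forall>p\<in>U. nabla X Y p - nabla Y X p = lie_bracket A X Y p))"

definition metric_compatible ::
    "'p::topological_space chart set \<Rightarrow> ('p \<Rightarrow> 'p tvec \<Rightarrow> 'p tvec \<Rightarrow> real) \<Rightarrow>
     ('p vfield \<Rightarrow> 'p vfield \<Rightarrow> 'p vfield) \<Rightarrow> bool" where
  "metric_compatible A g nabla \<longleftrightarrow>
     (\<forall>U X Y Z. open U \<and> smooth_vfield A U X \<and> smooth_vfield A U Y \<and> smooth_vfield A U Z \<longrightarrow>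
        (\<forall>p\<in>U. dir_deriv A X (\<lambda>q. g q (Y q) (Z q)) p
                 = g p (nabla X Y p) (Z p) + g p (Y p) (nabla X Z p)))"

definition levi_civita ::
    "'p::topological_space chart set \<Rightarrow> ('p \<Rightarrow> 'p tvec \<Rightarrow> 'p tvec \<Rightarrow> real) \<Rightarrow>
     ('p vfield \<Rightarrow> 'p vfield \<Rightarrow> 'p vfield) \<Rightarrow> bool" where
  "levi_civita A g nabla \<longleftrightarrow>
     affine_connection A nabla \<and> torsion_free A nabla \<and> metric_compatible A g nabla"

text \<open>Here \<open>(\<nabla>\<^sub>X \<phi>) Y = \<nabla>\<^sub>X (\<phi> Y) - \<phi> (\<nabla>\<^sub>X Y)\<close>.\<close>

definition sasaki_like ::
    "'p::topological_space chart set \<Rightarrow> ('p \<Rightarrow> 'p tvec \<Rightarrow> 'p tvec) \<Rightarrow> 'p vfield \<Rightarrow>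
     ('p \<Rightarrow> 'p tvec \<Rightarrow> real) \<Rightarrow> ('p \<Rightarrow> 'p tvec \<Rightarrow> 'p tvec \<Rightarrow> real) \<Rightarrow>
     ('p vfield \<Rightarrow> 'p vfield \<Rightarrow> 'p vfield) \<Rightarrow> bool" where
  "sasaki_like A \<phi> \<xi> \<eta> g nabla \<longleftrightarrow>
     (\<forall>U X Y. open U \<and> smooth_vfield A U X \<and> smooth_vfield A U Y \<longrightarrow>
        (\<forall>p\<in>U. nabla X (\<lambda>q. \<phi> q (Y q)) p - \<phi> p (nabla X Y p)
           = - (g p (X p) (Y p) *\<^sub>R \<xi> p) - \<eta> p (Y p) *\<^sub>R X p
             + (2 * \<eta> p (X p) * \<eta> p (Y p)) *\<^sub>R \<xi> p))"


section \<open>Curves\<close>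

text \<open>
  Smoothness of a function of one real variable on a set \<open>J\<close> without isolated points; at the
  endpoints of an interval the derivatives are one-sided. The sequence \<open>F\<close> consists of the iterated
  derivatives.
\<close>

definition smooth_real_on :: "real set \<Rightarrow> (real \<Rightarrow> 'b::real_normed_vector) \<Rightarrow> bool" where
  "smooth_real_on J f \<longleftrightarrow> (\<exists>F :: nat \<Rightarrow> real \<Rightarrow> 'b. (\<forall>t\<in>J. F 0 t = f t) \<and>
     (\<forall>n. \<forall>t\<in>J. (F n has_vector_derivative F (Suc n) t) (at t within J)))"

text \<open>Intervals need not be open or bounded, but are nondegenerate.\<close>

definition smooth_curve ::
    "'p::topological_space chart set \<Rightarrow> real set \<Rightarrow> (real \<Rightarrow> 'p) \<Rightarrow> bool" where
  "smooth_curve A I C \<longleftrightarrow>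
     is_interval I \<and> interior I \<noteq> {} \<and> continuous_on I C \<and>
     (\<forall>c\<in>A. smooth_real_on {t\<in>I. C t \<in> fst c} (snd c \<circ> C))"

definition velocity :: "'p chart set \<Rightarrow> real set \<Rightarrow> (real \<Rightarrow> 'p) \<Rightarrow> real \<Rightarrow> 'p tvec" where
  "velocity A I C t = Tvec (\<lambda>c. if c \<in> A \<and> C t \<in> fst c then
     vector_derivative (snd c \<circ> C) (at t within I) else 0)"

definition smooth_field_along ::
    "'p chart set \<Rightarrow> real set \<Rightarrow> (real \<Rightarrow> 'p) \<Rightarrow> (real \<Rightarrow> 'p tvec) \<Rightarrow> bool" where
  "smooth_field_along A I C V \<longleftrightarrow>
     (\<forall>t\<in>I. V t \<in> tangent_space A (C t)) \<and>
     (\<forall>c\<in>A. smooth_real_on {t\<in>I. C t \<in> fst c} (\<lambda>t. component (V t) c))"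

text \<open>
  The covariant derivative along \<open>C\<close> of a vector field \<open>V\<close> along \<open>C\<close>. In a chart, with
  \<open>V = V\<^sup>j \<partial>\<^sub>j\<close> and \<open>C' = C'\<^sup>i \<partial>\<^sub>i\<close>, it is \<open>(V\<^sup>j)' \<partial>\<^sub>j + C'\<^sup>i V\<^sup>j \<nabla>\<^bsub>\<partial>i\<^esub> \<partial>\<^sub>j\<close>.
\<close>

definition covariant_deriv_along ::
    "'p chart set \<Rightarrow> ('p vfield \<Rightarrow> 'p vfield \<Rightarrow> 'p vfield) \<Rightarrow> real set \<Rightarrow> (real \<Rightarrow> 'p) \<Rightarrow>
     (real \<Rightarrow> 'p tvec) \<Rightarrow> real \<Rightarrow> 'p tvec" where
  "covariant_deriv_along A nabla I C V t = Tvec (\<lambda>c. if c \<in> A \<and> C t \<in> fst c then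
     vector_derivative (\<lambda>s. component (V s) c) (at t within I)
     + (\<Sum>i\<in>UNIV. \<Sum>j\<in>UNIV. (component (velocity A I C t) c $ i * component (V t) c $ j) *\<^sub>R
          component (nabla (coord_field A c i) (coord_field A c j) (C t)) c)
     else 0)"

abbreviation acceleration ::
    "'p chart set \<Rightarrow> ('p vfield \<Rightarrow> 'p vfield \<Rightarrow> 'p vfield) \<Rightarrow> real set \<Rightarrow> (real \<Rightarrow> 'p) \<Rightarrow>
     real \<Rightarrow> 'p tvec" where
  "acceleration A nabla I C \<equiv> covariant_deriv_along A nabla I C (velocity A I C)"

definition null_curve ::
    "'p::topological_space chart set \<Rightarrow> ('p \<Rightarrow> 'p tvec \<Rightarrow> 'p tvec \<Rightarrow> real) \<Rightarrow> real set \<Rightarrow>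
     (real \<Rightarrow> 'p) \<Rightarrow> bool" where
  "null_curve A g I C \<longleftrightarrow> smooth_curve A I C \<and>
     (\<forall>t\<in>I. g (C t) (velocity A I C t) (velocity A I C t) = 0 \<and> velocity A I C t \<noteq> 0)"

definition legendre_curve ::
    "'p chart set \<Rightarrow> ('p \<Rightarrow> 'p tvec \<Rightarrow> real) \<Rightarrow> real set \<Rightarrow> (real \<Rightarrow> 'p) \<Rightarrow> bool" where
  "legendre_curve A \<eta> I C \<longleftrightarrow> (\<forall>t\<in>I. \<eta> (C t) (velocity A I C t) = 0)"

text \<open>Geodesic up to reparametrization.\<close>

definition geodesic_curve ::
    "'p chart set \<Rightarrow> ('p vfield \<Rightarrow> 'p vfield \<Rightarrow> 'p vfield) \<Rightarrow> real set \<Rightarrow> (real \<Rightarrow> 'p) \<Rightarrow> bool" where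
  "geodesic_curve A nabla I C \<longleftrightarrow>
     (\<exists>h :: real \<Rightarrow> real. \<forall>t\<in>I. acceleration A nabla I C t = h t *\<^sub>R velocity A I C t)"

definition general_frenet_frame ::
    "'p chart set \<Rightarrow> ('p \<Rightarrow> 'p tvec \<Rightarrow> 'p tvec \<Rightarrow> real) \<Rightarrow> real set \<Rightarrow> (real \<Rightarrow> 'p) \<Rightarrow>
     (real \<Rightarrow> 'p tvec) \<Rightarrow> (real \<Rightarrow> 'p tvec) \<Rightarrow> bool" where
  "general_frenet_frame A g I C N W \<longleftrightarrow>
     smooth_field_along A I C N \<and> smooth_field_along A I C W \<and>
     (\<forall>t\<in>I. g (C t) (velocity A I C t) (N t) = 1 \<and> g (C t) (W t) (W t) = 1 \<and>
             g (C t) (N t) (N t) = 0 \<and> g (C t) (N t) (W t) = 0 \<and>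
             g (C t) (velocity A I C t) (W t) = 0)"

text \<open>
  In any general Frenet frame \<open>{C', N, W}\<close> with \<open>\<nabla>\<^bsub>C'\<^esub> C' = h C' + k\<^sub>1 W\<close>, a curve is geodesic in the
  above sense if and only if the curvature \<open>k\<^sub>1\<close> vanishes identically.
\<close>

lemma geodesic_curve_iff_curvature_zero:
  fixes h k1 :: "real \<Rightarrow> real"
  assumes metric: "pseudo_riemannian_metric A g"
    and frame: "general_frenet_frame A g I C N W"
    and frenet: "\<forall>t\<in>I. acceleration A nabla I C t = h t *\<^sub>R velocity A I C t + k1 t *\<^sub>R W t"
  shows "geodesic_curve A nabla I C \<longleftrightarrow> (\<forall>t\<in>I. k1 t = 0)"
proof
  assume "\<forall>t\<in>I. k1 t = 0"
  with frenet show "geodesic_curve A nabla I C"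
    by (auto simp: geodesic_curve_def)
next
  assume "geodesic_curve A nabla I C"
  then obtain f :: "real \<Rightarrow> real"
    where f: "\<forall>t\<in>I. acceleration A nabla I C t = f t *\<^sub>R velocity A I C t"
    by (auto simp: geodesic_curve_def)
  show "\<forall>t\<in>I. k1 t = 0"
  proof (intro ballI, rule ccontr)
    fix t assume t: "t \<in> I" and k1: "k1 t \<noteq> 0"
    define v where "v = velocity A I C t"
    define G where "G = g (C t)"
    define T where "T = tangent_space A (C t)"
    have W: "W t \<in> T" "G (W t) (W t) = 1" "G v (W t) = 0"
      using frame t by (auto simp: general_frenet_frame_def smooth_field_along_def v_def G_def T_def)
    have lin: "G (a *\<^sub>R W t) (W t) = a" for a
      using metric W(1,2)
      by (auto simp: pseudo_riemannian_metric_def linear_on_space_def G_def T_def)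
    have eq: "k1 t *\<^sub>R W t = (f t - h t) *\<^sub>R v"
      using f frenet t by (simp add: v_def algebra_simps)
    show False
    proof (cases "f t = h t")
      case True
      with eq k1 have "W t = 0" by simp
      with lin[of 0] lin[of 1] show False by simp
    next
      case False
      have "v = (1 / (f t - h t)) *\<^sub>R (f t - h t) *\<^sub>R v"
        using False by simp
      then have "v = (k1 t / (f t - h t)) *\<^sub>R W t"
        unfolding eq[symmetric] by simp
      with lin W(3) k1 False show False by simp
    qed
  qed
qed

end

theory Submission
  imports Defs
begin

text \<open>
  Along a Legendre curve \<open>C\<close> with velocity \<open>V\<close> the function \<open>g(V, \<xi>) = \<eta>(V)\<close> vanishes. Its derivative is
  \<open>g(\<nabla>\<^sub>V V, \<xi>) + g(V, \<nabla>\<^sub>V \<xi>)\<close>. If \<open>C\<close> is geodesic, then \<open>\<nabla>\<^sub>V V\<close> is a multiple of \<open>V\<close>, so the first term is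
  a multiple of \<open>\<eta>(V) = 0\<close>. The Sasaki-like condition gives \<open>\<nabla>\<^sub>V \<xi> = - \<phi> V\<close> up to multiples of \<open>\<xi>\<close>
  (\<open>sasaki_like_nabla_Reeb\<close>), so the second term is \<open>- g(V, \<phi> V)\<close>. Hence \<open>g(V, \<phi> V) = 0\<close>
  (\<open>legendre_geodesic_phi_orthogonal\<close>).

  If \<open>C\<close> is also null, this contradicts the nondegeneracy of \<open>g\<close>: since \<open>\<phi>\<close> squares to \<open>-1\<close> on
  \<open>ker \<eta>\<close>, the vectors \<open>V\<close>, \<open>\<phi> V\<close> and \<open>\<xi>\<close> form a basis of the three-dimensional tangent space
  whenever \<open>V\<close> is a nonzero vector of \<open>ker \<eta>\<close>, and \<open>V\<close> is orthogonal to all three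
  (\<open>isotropic_contact_plane_vector_zero\<close>).

  The differentiation takes place in one chart, at an interior parameter. There
  \<open>V = V\<^sup>j \<partial>\<^sub>j\<close> with coordinate fields \<open>\<partial>\<^sub>j\<close>, and metric compatibility, applied to \<open>\<partial>\<^sub>i\<close>, \<open>\<partial>\<^sub>j\<close> and
  \<open>\<xi>\<close>, yields the product rule (\<open>metric_product_rule_along_curve\<close>). The connection can only be
  applied to \<open>\<partial>\<^sub>i\<close> once these are known to be smooth in every chart, which needs the smoothness of
  composite maps (\<open>Ck_on_compose\<close>, \<open>smooth_coord_field\<close>).
\<close>

section \<open>Calculus of finitely often differentiable maps\<close>

lemma frechet_derivative_cong_open:
  assumes "open S" "x \<in> S" "\<And>y. y \<in> S \<Longrightarrow> f y = g y"
  shows "frechet_derivative f (at x) = frechet_derivative g (at x)"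
proof -
  have "(f has_derivative f') (at x) \<longleftrightarrow> (g has_derivative f') (at x)" for f'
    using assms has_derivative_transform_within_open[of f f' x UNIV S g]
      has_derivative_transform_within_open[of g f' x UNIV S f] by metis
  then show ?thesis
    unfolding frechet_derivative_def by simp
qed

lemma Ck_on_cong:
  assumes "open S" "\<And>x. x \<in> S \<Longrightarrow> f x = g x" "Ck_on k S f"
  shows "Ck_on k S g"
  using assms(2,3)
proof (induction k arbitrary: f g)
  case 0
  then show ?case
    by (auto cong: continuous_on_cong)
next
  case (Suc k)
  have "g differentiable (at x)" if "x \<in> S" for x
    using Suc.prems that assms(1) has_derivative_transform_within_open[of f _ x UNIV S g]
    unfolding Ck_on.simps differentiable_def by metis
  moreover have "Ck_on k S (\<lambda>x. frechet_derivative g (at x) v)" for v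
  proof (rule Suc.IH)
    show "Ck_on k S (\<lambda>x. frechet_derivative f (at x) v)"
      using Suc.prems(2) by simp
    show "frechet_derivative f (at x) v = frechet_derivative g (at x) v" if "x \<in> S" for x
      using frechet_derivative_cong_open[OF assms(1) that] Suc.prems(1) by metis
  qed
  ultimately show ?case by simp
qed

lemma Ck_on_subset:
  "Ck_on k S f \<Longrightarrow> T \<subseteq> S \<Longrightarrow> Ck_on k T f"
  by (induction k arbitrary: f) (auto intro: continuous_on_subset)

text \<open>
  This avoids reasoning about the choice operator in \<open>frechet_derivative\<close>: any explicit formula
  for the derivative on an open set may be used instead.
\<close>

lemma Ck_on_SucI:
  assumes "open S" "\<And>x. x \<in> S \<Longrightarrow> (f has_derivative f' x) (at x)"
    and "\<And>v. Ck_on k S (\<lambda>x. f' x v)"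
  shows "Ck_on (Suc k) S f"
proof -
  have "f' x v = frechet_derivative f (at x) v" if "x \<in> S" for x v
    using assms(2)[OF that] frechet_derivative_at by metis
  then have "Ck_on k S (\<lambda>x. frechet_derivative f (at x) v)" for v
    by (intro Ck_on_cong[OF assms(1) _ assms(3)])
  with assms(2) show ?thesis
    by (auto simp: differentiable_def)
qed

lemma Ck_on_SucD_derivative:
  assumes "Ck_on (Suc k) S f" "x \<in> S"
  shows "(f has_derivative frechet_derivative f (at x)) (at x)"
  using assms by (auto simp: frechet_derivative_works)

lemma Ck_on_SucD:
  "Ck_on (Suc k) S f \<Longrightarrow> Ck_on k S f"
proof (induction k arbitrary: f)
  case 0
  then show ?case
    by (auto intro!: continuous_at_imp_continuous_on differentiable_imp_continuous_within)
next
  case (Suc k)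
  show ?case
    unfolding Ck_on.simps(2)[of k]
    using Suc.prems Suc.IH unfolding Ck_on.simps(2)[of "Suc k"] by blast
qed

lemma Ck_on_const: "open S \<Longrightarrow> Ck_on k S (\<lambda>x. c)"
  by (induction k arbitrary: c)
    (simp, rule Ck_on_SucI[where f'="\<lambda>x v. 0"], auto)

lemma Ck_on_add:
  assumes "open S"
  shows "Ck_on k S f \<Longrightarrow> Ck_on k S g \<Longrightarrow> Ck_on k S (\<lambda>x. f x + g x)"
proof (induction k arbitrary: f g)
  case 0
  then show ?case by (auto intro: continuous_intros)
next
  case (Suc k)
  show ?case
  proof (rule Ck_on_SucI[OF assms])
    fix x assume "x \<in> S"
    then show "((\<lambda>x. f x + g x) has_derivative
        (\<lambda>v. frechet_derivative f (at x) v + frechet_derivative g (at x) v)) (at x)"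
      using Suc.prems by (intro has_derivative_add Ck_on_SucD_derivative)
  next
    fix v show "Ck_on k S (\<lambda>x. frechet_derivative f (at x) v + frechet_derivative g (at x) v)"
      using Suc by simp
  qed
qed

lemma Ck_on_sum:
  assumes "open S" "finite B" "\<And>b. b \<in> B \<Longrightarrow> Ck_on k S (f b)"
  shows "Ck_on k S (\<lambda>x. \<Sum>b\<in>B. f b x)"
  using assms(2,3)
  by (induction B) (auto intro: Ck_on_add Ck_on_const assms(1))

lemma Ck_on_bounded_linear:
  assumes "open S" "bounded_linear h"
  shows "Ck_on k S f \<Longrightarrow> Ck_on k S (\<lambda>x. h (f x))"
proof (induction k arbitrary: f)
  case 0
  then show ?case
    using assms(2) by (auto intro: bounded_linear.continuous_on)
next
  case (Suc k)
  show ?case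
  proof (rule Ck_on_SucI[OF assms(1)])
    fix x assume "x \<in> S"
    then show "((\<lambda>x. h (f x)) has_derivative (\<lambda>v. h (frechet_derivative f (at x) v))) (at x)"
      using Suc.prems assms(2)
      by (intro bounded_linear.has_derivative[of h] Ck_on_SucD_derivative)
  next
    fix v show "Ck_on k S (\<lambda>x. h (frechet_derivative f (at x) v))"
      using Suc by simp
  qed
qed

lemma Ck_on_scaleR:
  fixes f :: "'a::euclidean_space \<Rightarrow> real"
  assumes "open S"
  shows "Ck_on k S f \<Longrightarrow> Ck_on k S g \<Longrightarrow> Ck_on k S (\<lambda>x. f x *\<^sub>R g x)"
proof (induction k arbitrary: f g)
  case 0
  then show ?case by (auto intro: continuous_intros)
next
  case (Suc k)
  show ?case
  proof (rule Ck_on_SucI[OF assms])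
    fix x assume "x \<in> S"
    then show "((\<lambda>x. f x *\<^sub>R g x) has_derivative
        (\<lambda>v. f x *\<^sub>R frechet_derivative g (at x) v + frechet_derivative f (at x) v *\<^sub>R g x)) (at x)"
      using Suc.prems by (intro has_derivative_scaleR Ck_on_SucD_derivative)
  next
    fix v
    show "Ck_on k S (\<lambda>x. f x *\<^sub>R frechet_derivative g (at x) v
        + frechet_derivative f (at x) v *\<^sub>R g x)"
      using Suc.prems Suc.IH Ck_on_SucD[OF Suc.prems(1)] Ck_on_SucD[OF Suc.prems(2)]
      by (intro Ck_on_add[OF assms]) auto
  qed
qed

text \<open>
  By the chain rule, the derivative of the composite in direction \<open>v\<close> is
  \<open>\<Sum>b. (Dg(x) v \<bullet> b) Df(g(x)) b\<close>. The second factors are composites of one degree less, so the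
  induction is on the degree, for all \<open>f\<close> simultaneously. Expanding in a basis is necessary because
  \<open>Ck_on\<close> speaks about derivatives in constant directions only.
\<close>

lemma Ck_on_compose:
  fixes f :: "'b::euclidean_space \<Rightarrow> 'c::real_normed_vector" and g :: "'a::euclidean_space \<Rightarrow> 'b"
  assumes "open S" "g ` S \<subseteq> T"
  shows "Ck_on k T f \<Longrightarrow> Ck_on k S g \<Longrightarrow> Ck_on k S (\<lambda>x. f (g x))"
proof (induction k arbitrary: f)
  case 0
  with assms(2) show ?case
    by (auto intro: continuous_on_compose2)
next
  case (Suc k)
  have D: "(f has_derivative frechet_derivative f (at (g x))) (at (g x))" if "x \<in> S" for x
    using that assms(2) by (intro Ck_on_SucD_derivative[OF Suc.prems(1)]) auto
  show ?case
  proof (rule Ck_on_SucI[OF assms(1)])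
    fix x assume x: "x \<in> S"
    show "((\<lambda>x. f (g x)) has_derivative
        (\<lambda>v. \<Sum>b\<in>Basis. (frechet_derivative g (at x) v \<bullet> b) *\<^sub>R frechet_derivative f (at (g x)) b))
        (at x)"
    proof -
      have "linear (frechet_derivative f (at (g x)))"
        using D[OF x] has_derivative_linear by blast
      then have "frechet_derivative f (at (g x)) (\<Sum>b\<in>Basis. (w \<bullet> b) *\<^sub>R b) =
          (\<Sum>b\<in>Basis. (w \<bullet> b) *\<^sub>R frechet_derivative f (at (g x)) b)" for w
        by (simp only: linear_sum linear_scale)
      then have "frechet_derivative f (at (g x)) w =
          (\<Sum>b\<in>Basis. (w \<bullet> b) *\<^sub>R frechet_derivative f (at (g x)) b)" for w
        unfolding euclidean_representation .
      moreover have "((\<lambda>x. f (g x)) has_derivative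
          (\<lambda>v. frechet_derivative f (at (g x)) (frechet_derivative g (at x) v))) (at x)"
        using has_derivative_compose[OF Ck_on_SucD_derivative[OF Suc.prems(2) x] D[OF x]] .
      ultimately show ?thesis by (metis (no_types, lifting) ext)
    qed
  next
    fix v
    have "Ck_on k S (\<lambda>x. frechet_derivative g (at x) v \<bullet> b)" for b
      using Suc.prems(2) by (intro Ck_on_bounded_linear[OF assms(1) bounded_linear_inner_left]) simp
    moreover have "Ck_on k S (\<lambda>x. frechet_derivative f (at (g x)) b)" for b
      using Suc.prems(1) Ck_on_SucD[OF Suc.prems(2)]
      by (intro Suc.IH[where f = "\<lambda>y. frechet_derivative f (at y) b"]) simp_all
    ultimately have "Ck_on k S (\<lambda>x. (frechet_derivative g (at x) v \<bullet> b) *\<^sub>R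
        frechet_derivative f (at (g x)) b)" for b
      by (rule Ck_on_scaleR[OF assms(1)])
    then show "Ck_on k S (\<lambda>x. \<Sum>b\<in>Basis. (frechet_derivative g (at x) v \<bullet> b) *\<^sub>R
        frechet_derivative f (at (g x)) b)"
      by (rule Ck_on_sum[OF assms(1) finite_Basis])
  qed
qed

lemma smooth_on_subset: "smooth_on S f \<Longrightarrow> T \<subseteq> S \<Longrightarrow> smooth_on T f"
  unfolding smooth_on_def by (blast intro: Ck_on_subset)

lemma smooth_on_cong:
  "open S \<Longrightarrow> (\<And>x. x \<in> S \<Longrightarrow> f x = g x) \<Longrightarrow> smooth_on S f \<Longrightarrow> smooth_on S g"
  unfolding smooth_on_def by (blast intro: Ck_on_cong)

lemma smooth_on_compose:
  fixes f :: "'b::euclidean_space \<Rightarrow> 'c::real_normed_vector" and g :: "'a::euclidean_space \<Rightarrow> 'b"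
  shows "open S \<Longrightarrow> g ` S \<subseteq> T \<Longrightarrow> smooth_on T f \<Longrightarrow> smooth_on S g \<Longrightarrow> smooth_on S (\<lambda>x. f (g x))"
  unfolding smooth_on_def by (blast intro: Ck_on_compose)

lemma smooth_on_frechet_derivative:
  "smooth_on S f \<Longrightarrow> smooth_on S (\<lambda>x. frechet_derivative f (at x) v)"
  unfolding smooth_on_def using Ck_on.simps(2) by blast

lemma smooth_on_has_derivative:
  "smooth_on S f \<Longrightarrow> x \<in> S \<Longrightarrow> (f has_derivative frechet_derivative f (at x)) (at x)"
  unfolding smooth_on_def by (blast intro: Ck_on_SucD_derivative)

section \<open>Charts and tangent vectors\<close>

lemma smooth_manifold3D:
  assumes "smooth_manifold3 A" "c \<in> A"
  shows "is_chart c" "open (fst c)" "inj_on (snd c) (fst c)"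
  using assms unfolding smooth_manifold3_def is_chart_def homeomorphism_def
  by (auto intro: inj_on_inverseI) (metis inj_on_inverseI)

lemma chart_inv_left:
  "smooth_manifold3 A \<Longrightarrow> c \<in> A \<Longrightarrow> p \<in> fst c \<Longrightarrow> chart_inv c (snd c p) = p"
  by (simp add: smooth_manifold3D(3))

lemma chart_at:
  assumes "smooth_manifold3 A"
  shows "chart_at A p \<in> A" "p \<in> fst (chart_at A p)"
proof -
  have "\<exists>c. c \<in> A \<and> p \<in> fst c"
    using assms UNIV_I[of p] unfolding smooth_manifold3_def by (metis UN_iff)
  then have "chart_at A p \<in> A \<and> p \<in> fst (chart_at A p)"
    unfolding chart_at_def by (rule someI_ex)
  then show "chart_at A p \<in> A" "p \<in> fst (chart_at A p)" by auto
qed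

lemma open_chart_image:
  assumes "smooth_manifold3 A" "c \<in> A" "open U"
  shows "open (chart_image c U)"
proof -
  obtain y where y: "homeomorphism (fst c) (snd c ` fst c) (snd c) y"
    and o: "open (snd c ` fst c)" "open (fst c)"
    using smooth_manifold3D(1)[OF assms(1,2)] unfolding is_chart_def by blast
  have "openin (top_of_set (snd c ` fst c)) (snd c ` (U \<inter> fst c))"
    using y o(2) assms(3) by (intro homeomorphism_imp_open_map[OF y]) (auto simp: openin_open_eq)
  with o(1) show ?thesis
    by (simp add: openin_open_eq)
qed

lemma component_simps:
  "component 0 c = 0" "component (v + w) c = component v c + component w c"
  "component (v - w) c = component v c - component w c"
  "component (- v) c = - component v c"
  "component (a *\<^sub>R v) c = a *\<^sub>R component v c"
  by (simp_all add: zero_tvec_def plus_tvec_def minus_tvec_def uminus_tvec_def scaleR_tvec_def)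

lemma component_sum: "component (\<Sum>i\<in>S. f i) c = (\<Sum>i\<in>S. component (f i) c)"
  by (induction S rule: infinite_finite_induct) (auto simp: component_simps)

definition jacobian :: "'p chart \<Rightarrow> 'p chart \<Rightarrow> 'p \<Rightarrow> real^3 \<Rightarrow> real^3" where
  "jacobian c d p = frechet_derivative (snd d \<circ> chart_inv c) (at (snd c p))"

lemma tangent_space_component:
  assumes "v \<in> tangent_space A p" "c \<in> A" "d \<in> A" "p \<in> fst c" "p \<in> fst d"
  shows "component v d = jacobian c d p (component v c)"
proof -
  have "\<forall>c\<in>A. \<forall>d\<in>A. p \<in> fst c \<inter> fst d \<longrightarrow> component v d = jacobian c d p (component v c)"
    using assms(1) unfolding tangent_space_def jacobian_def mem_Collect_eq by (rule conjunct1)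
  with assms(2-) show ?thesis by blast
qed

lemma component_outside:
  "v \<in> tangent_space A p \<Longrightarrow> \<not> (d \<in> A \<and> p \<in> fst d) \<Longrightarrow> component v d = 0"
  unfolding tangent_space_def by (simp del: split_paired_All)

text \<open>
  The Jacobians determine all components of a tangent vector from one of them.
\<close>

lemma tangent_space_eqI:
  assumes "v \<in> tangent_space A p" "w \<in> tangent_space A p" "c \<in> A" "p \<in> fst c"
    and "component v c = component w c"
  shows "v = w"
  unfolding tvec_eq_iff
proof
  fix d
  show "component v d = component w d"
    using tangent_space_component[OF assms(1,3) _ assms(4), of d]
      tangent_space_component[OF assms(2,3) _ assms(4), of d] assms(5)
      component_outside[OF assms(1), of d] component_outside[OF assms(2), of d]
    by argo
qed

section \<open>Metrics and connections on vector fields\<close>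

lemma linear_on_spaceD:
  assumes "linear_on_space V f"
  shows "v \<in> V \<Longrightarrow> w \<in> V \<Longrightarrow> f (v + w) = f v + f w"
    and "v \<in> V \<Longrightarrow> f (a *\<^sub>R v) = a *\<^sub>R f v"
    and "v \<in> V \<Longrightarrow> f 0 = 0"
    and "v \<in> V \<Longrightarrow> f (- v) = - f v"
proof -
  show "f (v + w) = f v + f w" if "v \<in> V" "w \<in> V"
    using assms that unfolding linear_on_space_def by blast
  show s: "f (a *\<^sub>R v) = a *\<^sub>R f v" if "v \<in> V" for a
    using assms that unfolding linear_on_space_def by blast
  show "f 0 = 0" if "v \<in> V"
    using s[OF that, of 0] by simp
  show "f (- v) = - f v" if "v \<in> V"
    using s[OF that, of "-1"] by simp
qed

lemma linear_on_space_sum: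
  assumes "subspace V" "linear_on_space V f" "finite S" "\<And>i. i \<in> S \<Longrightarrow> v i \<in> V"
  shows "f (\<Sum>i\<in>S. a i *\<^sub>R v i) = (\<Sum>i\<in>S. a i *\<^sub>R f (v i))"
  using assms(3,4)
proof (induction S)
  case empty
  have "f (0 *\<^sub>R 0) = 0 *\<^sub>R f 0"
    using assms(1,2) subspace_0 unfolding linear_on_space_def by blast
  then show ?case by simp
next
  case (insert i S)
  have "(\<Sum>i\<in>S. a i *\<^sub>R v i) \<in> V" "v i \<in> V"
    using insert.prems assms(1) by (auto intro!: subspace_sum subspace_scale)
  then have "f (a i *\<^sub>R v i + (\<Sum>i\<in>S. a i *\<^sub>R v i)) = a i *\<^sub>R f (v i) + f (\<Sum>i\<in>S. a i *\<^sub>R v i)"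
    using assms(1,2) subspace_scale unfolding linear_on_space_def by metis
  with insert show ?case by simp
qed

lemma metric_linear:
  assumes "pseudo_riemannian_metric A g" "v \<in> tangent_space A p"
  shows "linear_on_space (tangent_space A p) (\<lambda>w. g p v w)"
    "linear_on_space (tangent_space A p) (\<lambda>w. g p w v)"
  using assms unfolding pseudo_riemannian_metric_def by simp_all

lemma smooth_metric:
  assumes "pseudo_riemannian_metric A g" "open U" "smooth_vfield A U X" "smooth_vfield A U Y"
  shows "smooth_function A U (\<lambda>p. g p (X p) (Y p))"
  using assms(1)[unfolded pseudo_riemannian_metric_def, THEN conjunct2, THEN spec, THEN spec, THEN spec,
      THEN mp, OF conjI, OF assms(2) conjI, OF assms(3,4)] .

lemma smooth_vfield_subset:
  assumes "smooth_vfield A U X" "V \<subseteq> U"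
  shows "smooth_vfield A V X"
  unfolding smooth_vfield_def
proof (intro conjI ballI)
  show "X p \<in> tangent_space A p" if "p \<in> V" for p
    using assms that unfolding smooth_vfield_def by blast
  show "smooth_on (chart_image c V) (\<lambda>z. component (X (chart_inv c z)) c)" if "c \<in> A" for c
    by (rule smooth_on_subset[of "chart_image c U"])
      (use assms that in \<open>auto simp: smooth_vfield_def\<close>)
qed

lemma levi_civitaD:
  assumes "levi_civita A g nabla" "open U" "smooth_vfield A U X" "smooth_vfield A U Y"
  shows smooth_nabla: "smooth_vfield A U (nabla X Y)"
    and nabla_metric: "\<lbrakk>smooth_vfield A U Z; p \<in> U\<rbrakk> \<Longrightarrow> dir_deriv A X (\<lambda>q. g q (Y q) (Z q)) p
      = g p (nabla X Y p) (Z p) + g p (Y p) (nabla X Z p)"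
    and nabla_add: "\<lbrakk>smooth_vfield A U Z; p \<in> U\<rbrakk> \<Longrightarrow>
      nabla X (\<lambda>q. Y q + Z q) p = nabla X Y p + nabla X Z p"
proof -
  have "affine_connection A nabla" and mc: "metric_compatible A g nabla"
    using assms(1) by (simp_all add: levi_civita_def)
  note aff = this(1)[unfolded affine_connection_def, THEN spec, THEN mp, OF assms(2)]
  show "smooth_vfield A U (nabla X Y)"
    by (rule aff[THEN conjunct1, THEN spec, THEN spec, THEN mp, OF conjI, OF assms(3,4)])
  assume Z: "smooth_vfield A U Z" and p: "p \<in> U"
  show "dir_deriv A X (\<lambda>q. g q (Y q) (Z q)) p = g p (nabla X Y p) (Z p) + g p (Y p) (nabla X Z p)"
    by (rule mc[unfolded metric_compatible_def, rule_format, of U X Y Z p]) (simp_all add: assms Z p)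
  show "nabla X (\<lambda>q. Y q + Z q) p = nabla X Y p + nabla X Z p"
    by (rule aff[THEN conjunct2, THEN conjunct2, THEN conjunct2, THEN conjunct1, rule_format, of X Y Z p])
      (simp_all add: assms Z p)
qed

section \<open>Jacobians and coordinate fields of a smooth 3-manifold\<close>

locale smooth_3manifold =
  fixes A :: "'p::{t2_space,second_countable_topology} chart set"
  assumes manifold: "smooth_manifold3 A"
begin

lemma transition_smooth:
  assumes "c \<in> A" "d \<in> A"
  shows "smooth_on (chart_image c (fst d)) (snd d \<circ> chart_inv c)"
  using manifold assms unfolding smooth_manifold3_def by simp

lemma transition_has_derivative:
  assumes "c \<in> A" "d \<in> A" "p \<in> fst c" "p \<in> fst d"
  shows "((snd d \<circ> chart_inv c) has_derivative jacobian c d p) (at (snd c p))"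
  unfolding jacobian_def
  using assms by (intro smooth_on_has_derivative[OF transition_smooth]) auto

lemma linear_jacobian:
  assumes "c \<in> A" "d \<in> A" "p \<in> fst c" "p \<in> fst d"
  shows "linear (jacobian c d p)"
  using transition_has_derivative[OF assms] has_derivative_linear by blast

lemma jacobian_self:
  assumes "c \<in> A" "p \<in> fst c"
  shows "jacobian c c p = (\<lambda>v. v)"
proof -
  have "jacobian c c p = frechet_derivative (\<lambda>z. z) (at (snd c p))"
    unfolding jacobian_def
    using assms open_chart_image[OF manifold assms(1) open_UNIV]
    by (intro frechet_derivative_cong_open[of "chart_image c UNIV"]) (auto simp: f_inv_into_f)
  then show ?thesis by simp
qed

lemma jacobian_cocycle:
  assumes "c \<in> A" "d \<in> A" "e \<in> A" "p \<in> fst c" "p \<in> fst d" "p \<in> fst e"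
  shows "jacobian d e p (jacobian c d p v) = jacobian c e p v"
proof -
  have c: "chart_inv c (snd c p) = p"
    using chart_inv_left[OF manifold] assms by blast
  have "(((snd e \<circ> chart_inv d) \<circ> (snd d \<circ> chart_inv c)) has_derivative
      (jacobian d e p \<circ> jacobian c d p)) (at (snd c p))"
    using transition_has_derivative assms c by (intro diff_chain_at) auto
  moreover have "open (chart_image c (fst d))"
    using open_chart_image[OF manifold assms(1)] smooth_manifold3D(2)[OF manifold assms(2)] .
  moreover have "snd c p \<in> chart_image c (fst d)"
    using assms by blast
  moreover have "((snd e \<circ> chart_inv d) \<circ> (snd d \<circ> chart_inv c)) z = (snd e \<circ> chart_inv c) z"
    if "z \<in> chart_image c (fst d)" for z
    using that chart_inv_left[OF manifold] assms by auto
  ultimately have "((snd e \<circ> chart_inv c) has_derivative (jacobian d e p \<circ> jacobian c d p)) (at (snd c p))"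
    using has_derivative_transform_within_open by blast
  then show ?thesis
    using frechet_derivative_at unfolding jacobian_def comp_def by metis
qed

text \<open>
  By the cocycle rule for Jacobians, the transformation law need only be checked against one chart
  around the point.
\<close>

lemma tangent_vectorI:
  assumes "c \<in> A" "p \<in> fst c"
    and "\<And>d. d \<in> A \<Longrightarrow> p \<in> fst d \<Longrightarrow> component v d = jacobian c d p w"
    and "\<And>d. \<not> (d \<in> A \<and> p \<in> fst d) \<Longrightarrow> component v d = 0"
  shows "v \<in> tangent_space A p"
  using assms jacobian_cocycle[OF assms(1) _ _ assms(2), of _ _ w]
  unfolding tangent_space_def by (auto simp: jacobian_def[symmetric])

lemma subspace_tangent_space: "subspace (tangent_space A p)"
proof -
  define c where "c = chart_at A p"
  have c: "c \<in> A" "p \<in> fst c"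
    using chart_at[OF manifold] by (simp_all add: c_def)
  note lin = linear_jacobian[OF c(1) _ c(2)]
  note comp = tangent_space_component[OF _ c(1) _ c(2)]
  show ?thesis
    unfolding subspace_def
  proof (intro conjI ballI allI)
    show "0 \<in> tangent_space A p"
      by (rule tangent_vectorI[OF c, of _ 0]) (simp_all add: component_simps linear_0[OF lin])
  next
    fix v w assume v: "v \<in> tangent_space A p" and w: "w \<in> tangent_space A p"
    show "v + w \<in> tangent_space A p"
      by (rule tangent_vectorI[OF c, of _ "component v c + component w c"])
        (simp_all add: component_simps linear_add[OF lin] comp[OF v] comp[OF w]
          component_outside[OF v] component_outside[OF w])
  next
    fix a v assume v: "v \<in> tangent_space A p"
    show "a *\<^sub>R v \<in> tangent_space A p"
      by (rule tangent_vectorI[OF c, of _ "a *\<^sub>R component v c"])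
        (simp_all add: component_simps linear_scale[OF lin] comp[OF v] component_outside[OF v])
  qed
qed

lemma component_coord_field:
  assumes "d \<in> A" "p \<in> fst d"
  shows "component (coord_field A c i p) d = jacobian c d p (axis i 1)"
  using assms by (simp add: coord_field_def jacobian_def)

lemma coord_field_tangent:
  assumes "c \<in> A" "p \<in> fst c"
  shows "coord_field A c i p \<in> tangent_space A p"
  by (rule tangent_vectorI[OF assms, of _ "axis i 1"])
    (simp add: component_coord_field, auto simp: coord_field_def)

lemma coord_field_expansion:
  assumes "c \<in> A" "p \<in> fst c" "v \<in> tangent_space A p"
  shows "v = (\<Sum>i\<in>UNIV. (component v c $ i) *\<^sub>R coord_field A c i p)"
proof (rule tangent_space_eqI[OF assms(3) _ assms(1,2)])
  show "(\<Sum>i\<in>UNIV. (component v c $ i) *\<^sub>R coord_field A c i p) \<in> tangent_space A p"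
    using coord_field_tangent[OF assms(1,2)] subspace_tangent_space
    by (intro subspace_sum subspace_scale) auto
  show "component v c = component (\<Sum>i\<in>UNIV. (component v c $ i) *\<^sub>R coord_field A c i p) c"
    using basis_expansion[of "component v c"]
    by (simp add: component_sum component_simps component_coord_field[OF assms(1,2)]
        jacobian_self[OF assms(1,2)] scalar_mult_eq_scaleR)
qed

text \<open>
  In a chart \<open>d\<close>, the components of the field are a column of the Jacobian of the coordinate change
  from \<open>c\<close> to \<open>d\<close>, composed with the coordinate change from \<open>d\<close> to \<open>c\<close>.
\<close>

lemma smooth_coord_field:
  assumes c: "c \<in> A"
  shows "smooth_vfield A (fst c) (coord_field A c i)"
proof -
  have "smooth_on (chart_image d (fst c)) (\<lambda>z. component (coord_field A c i (chart_inv d z)) d)"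
    if d: "d \<in> A" for d
  proof (rule smooth_on_cong)
    show op: "open (chart_image d (fst c))"
      using open_chart_image[OF manifold d smooth_manifold3D(2)[OF manifold c]] .
    show "smooth_on (chart_image d (fst c))
        (\<lambda>z. frechet_derivative (snd d \<circ> chart_inv c) (at ((snd c \<circ> chart_inv d) z)) (axis i 1))"
    proof (rule smooth_on_compose[OF op, where g = "snd c \<circ> chart_inv d"
          and f = "\<lambda>y. frechet_derivative (snd d \<circ> chart_inv c) (at y) (axis i 1)"])
      show "(snd c \<circ> chart_inv d) ` chart_image d (fst c) \<subseteq> chart_image c (fst d)"
        by (auto simp: chart_inv_left[OF manifold d])
    qed (intro smooth_on_frechet_derivative transition_smooth c d)+
    show "frechet_derivative (snd d \<circ> chart_inv c) (at ((snd c \<circ> chart_inv d) z)) (axis i 1)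
        = component (coord_field A c i (chart_inv d z)) d" if "z \<in> chart_image d (fst c)" for z
      using that by (auto simp: chart_inv_left[OF manifold d] component_coord_field[OF d] jacobian_def)
  qed
  then show ?thesis
    by (simp add: smooth_vfield_def coord_field_tangent c)
qed

section \<open>Velocities and the product rule along a curve\<close>

text \<open>
  At interior parameters the one-sided derivatives in the definition of a smooth curve become ordinary
  ones, and the velocity, defined through derivatives within \<open>I\<close>, has the ordinary derivatives of the
  coordinates as its components.
\<close>

lemma curve_in_chart:
  assumes C: "smooth_curve A I C" and c: "c \<in> A"
  defines "S \<equiv> interior I \<inter> C -` fst c"
  obtains \<gamma>2 where "open S"
    "\<And>s. s \<in> S \<Longrightarrow> ((snd c \<circ> C) has_vector_derivative component (velocity A I C s) c) (at s)"
    "\<And>s. s \<in> S \<Longrightarrow> ((\<lambda>s. component (velocity A I C s) c) has_vector_derivative \<gamma>2 s) (at s)"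
proof -
  let ?J = "{t\<in>I. C t \<in> fst c}"
  have I: "continuous_on I C" and smooth: "smooth_real_on ?J (snd c \<circ> C)"
    using C c by (simp_all add: smooth_curve_def)
  have S: "open S"
    unfolding S_def
    using continuous_open_preimage[OF continuous_on_subset[OF I interior_subset] open_interior
        smooth_manifold3D(2)[OF manifold c]] .
  have sub: "S \<subseteq> ?J"
    using interior_subset[of I] by (auto simp: S_def)
  obtain F :: "nat \<Rightarrow> real \<Rightarrow> real^3" where F: "\<forall>t\<in>?J. F 0 t = (snd c \<circ> C) t"
    "\<forall>n. \<forall>t\<in>?J. (F n has_vector_derivative F (Suc n) t) (at t within ?J)"
    using smooth unfolding smooth_real_on_def by (elim exE conjE)
  have D: "(F n has_vector_derivative F (Suc n) s) (at s)" if s: "s \<in> S" for n s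
  proof -
    have "at s within ?J = at s"
      by (rule at_within_interior, rule interiorI[OF S s sub])
    then show ?thesis
      using F(2)[rule_format, OF subsetD[OF sub s], of n] by metis
  qed
  have D0: "((snd c \<circ> C) has_vector_derivative F 1 s) (at s)" if s: "s \<in> S" for s
    using D[OF s, of 0] F(1)[rule_format, OF subsetD[OF sub]] unfolding One_nat_def
    by (rule has_vector_derivative_transform_within_open[OF _ S s])
  have v: "F 1 s = component (velocity A I C s) c" if s: "s \<in> S" for s
  proof -
    have s': "s \<in> interior I" "C s \<in> fst c"
      using s unfolding S_def by blast+
    have "vector_derivative (snd c \<circ> C) (at s within I) = F 1 s"
      unfolding at_within_interior[OF s'(1)] by (rule vector_derivative_at[OF D0[OF s]])
    then show ?thesis
      unfolding velocity_def component_Tvec using c s'(2) by presburger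
  qed
  have D1: "((\<lambda>s. component (velocity A I C s) c) has_vector_derivative F (Suc 1) s) (at s)"
    if s: "s \<in> S" for s
    using D[OF s, of 1] v by (rule has_vector_derivative_transform_within_open[OF _ S s])
  show thesis
  proof (rule that[OF S])
    show "((snd c \<circ> C) has_vector_derivative component (velocity A I C s) c) (at s)"
      if "s \<in> S" for s
      using D0[OF that] unfolding v[OF that] .
  qed (rule D1)
qed

lemma velocity_tangent:
  assumes C: "smooth_curve A I C" and t: "t \<in> interior I"
  shows "velocity A I C t \<in> tangent_space A (C t)"
proof -
  define c where "c = chart_at A (C t)"
  have c: "c \<in> A" "C t \<in> fst c"
    using chart_at[OF manifold] by (simp_all add: c_def)
  let ?S = "\<lambda>d. interior I \<inter> C -` fst d"
  have D: "open (?S d)" "((snd d \<circ> C) has_vector_derivative component (velocity A I C t) d) (at t)"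
    if "d \<in> A" "C t \<in> fst d" for d
  proof -
    show "open (?S d)"
      by (rule curve_in_chart[OF C that(1)])
    show "((snd d \<circ> C) has_vector_derivative component (velocity A I C t) d) (at t)"
      by (rule curve_in_chart[OF C that(1)]) (use t that(2) in simp)
  qed
  show ?thesis
  proof (rule tangent_vectorI[OF c, of _ "component (velocity A I C t) c"])
    fix d assume d: "d \<in> A" "C t \<in> fst d"
    have "((snd d \<circ> chart_inv c \<circ> (snd c \<circ> C)) has_vector_derivative
        jacobian c d (C t) (component (velocity A I C t) c)) (at t)"
      using vector_derivative_diff_chain_within[of "snd c \<circ> C" _ t UNIV "snd d \<circ> chart_inv c"]
        D(2)[OF c] transition_has_derivative[OF c(1) d(1) c(2) d(2)]
      by (simp add: has_derivative_at_withinI)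
    then have "((snd d \<circ> C) has_vector_derivative
        jacobian c d (C t) (component (velocity A I C t) c)) (at t)"
      by (rule has_vector_derivative_transform_within_open[OF _ D(1)[OF c]])
        (use t c chart_inv_left[OF manifold c(1)] in auto)
    then show "component (velocity A I C t) d = jacobian c d (C t) (component (velocity A I C t) c)"
      using D(2)[OF d] vector_derivative_unique_at by blast
  qed (auto simp: velocity_def)
qed

text \<open>
  The chart is the one that \<open>dir_deriv\<close> selects at \<open>C t\<close>; then the chain rule applies to the coordinate
  representation of \<open>f\<close> and no change of charts is needed.
\<close>

lemma smooth_function_along_curve:
  assumes c: "c = chart_at A (C t)" and C: "((snd c \<circ> C) has_vector_derivative u) (at t)"
    and S: "open S" "t \<in> S" "\<And>s. s \<in> S \<Longrightarrow> C s \<in> fst c"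
    and f: "smooth_function A (fst c) f"
  shows "((\<lambda>s. f (C s)) has_real_derivative
    (\<Sum>i\<in>UNIV. u $ i * dir_deriv A (coord_field A c i) f (C t))) (at t)"
proof -
  have cA: "c \<in> A" "C t \<in> fst c"
    using chart_at[OF manifold] by (simp_all add: c)
  let ?F = "f \<circ> chart_inv c" and ?z = "snd c (C t)"
  have F: "(?F has_derivative frechet_derivative ?F (at ?z)) (at ?z)"
    using f cA by (intro smooth_on_has_derivative[of "chart_image c (fst c)"])
      (auto simp: smooth_function_def)
  have comp: "component (coord_field A c i (C t)) c = axis i 1" for i
    using component_coord_field[OF cA] jacobian_self[OF cA] by simp
  have "dir_deriv A (coord_field A c i) f (C t) = frechet_derivative ?F (at ?z) (axis i 1)" for i
    unfolding dir_deriv_def Let_def c[symmetric] comp ..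
  then have "(\<Sum>i\<in>UNIV. u $ i * dir_deriv A (coord_field A c i) f (C t))
      = (\<Sum>i\<in>UNIV. u $ i *\<^sub>R frechet_derivative ?F (at ?z) (axis i 1))"
    by simp
  also have "\<dots> = frechet_derivative ?F (at ?z) (\<Sum>i\<in>UNIV. u $ i *\<^sub>R axis i 1)"
    using has_derivative_linear[OF F] by (simp only: linear_sum linear_scale)
  also have "\<dots> = frechet_derivative ?F (at ?z) u"
    using basis_expansion[of u] by (simp add: scalar_mult_eq_scaleR)
  finally have eq: "(\<Sum>i\<in>UNIV. u $ i * dir_deriv A (coord_field A c i) f (C t))
    = frechet_derivative ?F (at ?z) u" .
  have "((?F \<circ> (snd c \<circ> C)) has_vector_derivative frechet_derivative ?F (at ?z) u) (at t)"
    using vector_derivative_diff_chain_within[of "snd c \<circ> C" _ t UNIV ?F] C F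
    by (simp add: has_derivative_at_withinI)
  then have "((\<lambda>s. f (C s)) has_vector_derivative frechet_derivative ?F (at ?z) u) (at t)"
    by (rule has_vector_derivative_transform_within_open[OF _ S(1,2)])
      (simp add: S(3) chart_inv_left[OF manifold cA(1)])
  then show ?thesis
    unfolding eq has_real_derivative_iff_has_vector_derivative .
qed

text \<open>
  This is \<open>d/dt g(V, Z) = g(D, Z) + g(V, \<nabla>\<^bsub>C'\<^esub> Z)\<close>, where \<open>D\<close> is the covariant derivative of \<open>V\<close> along
  the curve, characterized by its components in the chart, and \<open>u\<close> is the velocity. To prove it, write
  \<open>V = V\<^sup>j \<partial>\<^sub>j\<close> and differentiate \<open>V\<^sup>j g(\<partial>\<^sub>j, Z)\<close>, where metric compatibility gives the derivatives of the
  functions \<open>g(\<partial>\<^sub>j, Z)\<close>.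
\<close>

lemma metric_product_rule_along_curve:
  assumes g: "pseudo_riemannian_metric A g" and lc: "levi_civita A g nabla"
    and Z: "smooth_vfield A UNIV Z"
    and c: "c = chart_at A (C t)" and C: "((snd c \<circ> C) has_vector_derivative u) (at t)"
    and S: "open S" "t \<in> S" "\<And>s. s \<in> S \<Longrightarrow> C s \<in> fst c" "\<And>s. s \<in> S \<Longrightarrow> V s \<in> tangent_space A (C s)"
    and V: "((\<lambda>s. component (V s) c) has_vector_derivative V') (at t)"
    and D: "D \<in> tangent_space A (C t)"
      "component D c = V' + (\<Sum>i\<in>UNIV. \<Sum>j\<in>UNIV. (u $ i * component (V t) c $ j) *\<^sub>R
          component (nabla (coord_field A c i) (coord_field A c j) (C t)) c)"
  shows "((\<lambda>s. g (C s) (V s) (Z (C s))) has_real_derivative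
      g (C t) D (Z (C t)) + (\<Sum>i\<in>UNIV. u $ i * g (C t) (V t) (nabla (coord_field A c i) Z (C t)))) (at t)"
proof -
  let ?U = "fst c" and ?p = "C t" and ?d = "coord_field A c"
  define v where "v = component (V t) c"
  define G where "G = g ?p"
  define \<Gamma> where "\<Gamma> i j = nabla (?d i) (?d j) ?p" for i j
  define Nz where "Nz i = nabla (?d i) Z ?p" for i
  have cA: "c \<in> A" "?p \<in> ?U"
    using chart_at[OF manifold] by (simp_all add: c)
  have U: "open ?U"
    using smooth_manifold3D(2)[OF manifold cA(1)] .
  have Zc: "smooth_vfield A ?U Z"
    by (rule smooth_vfield_subset[OF Z]) simp
  note d = smooth_coord_field[OF cA(1)]
  have tangent: "X q \<in> tangent_space A q" if "smooth_vfield A ?U X" "q \<in> ?U" for X q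
    using that unfolding smooth_vfield_def by simp
  have Zt: "Z q \<in> tangent_space A q" for q
    using Z unfolding smooth_vfield_def by simp
  have \<Gamma>t: "\<Gamma> i j \<in> tangent_space A ?p" for i j
    unfolding \<Gamma>_def by (rule tangent[OF smooth_nabla[OF lc U d d] cA(2)])
  have Nt: "Nz i \<in> tangent_space A ?p" for i
    unfolding Nz_def by (rule tangent[OF smooth_nabla[OF lc U d Zc] cA(2)])
  note lin = linear_on_space_sum[OF subspace_tangent_space metric_linear(1)[OF g]]
    linear_on_space_sum[OF subspace_tangent_space metric_linear(2)[OF g]]
  have exp: "g (C s) (V s) W = (\<Sum>j\<in>UNIV. component (V s) c $ j * g (C s) (?d j (C s)) W)"
    if "s \<in> S" "W \<in> tangent_space A (C s)" for s W
    using lin(2)[OF that(2) finite_class.finite_UNIV, of "\<lambda>j. ?d j (C s)" "\<lambda>j. component (V s) c $ j"]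
      coord_field_expansion[OF cA(1) S(3)[OF that(1)] S(4)[OF that(1)]]
      tangent[OF d S(3)[OF that(1)]] by simp
  have "((\<lambda>s. g (C s) (?d j (C s)) (Z (C s))) has_real_derivative
      (\<Sum>i\<in>UNIV. u $ i * (G (\<Gamma> i j) (Z ?p) + G (?d j ?p) (Nz i)))) (at t)" for j
    using smooth_function_along_curve[OF c C S(1-3) smooth_metric[OF g U d Zc], of j]
      nabla_metric[OF lc U d d Zc cA(2)]
    by (simp add: G_def \<Gamma>_def Nz_def)
  moreover have "((\<lambda>s. component (V s) c $ j) has_real_derivative V' $ j) (at t)" for j
    using bounded_linear.has_vector_derivative[OF bounded_linear_vec_nth V]
    unfolding has_real_derivative_iff_has_vector_derivative .
  ultimately have "((\<lambda>s. \<Sum>j\<in>UNIV. component (V s) c $ j * g (C s) (?d j (C s)) (Z (C s)))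
      has_real_derivative (\<Sum>j\<in>UNIV. v $ j * (\<Sum>i\<in>UNIV. u $ i * (G (\<Gamma> i j) (Z ?p) + G (?d j ?p) (Nz i)))
        + V' $ j * G (?d j ?p) (Z ?p))) (at t)"
    unfolding v_def G_def by (intro DERIV_sum DERIV_mult')
  then have "((\<lambda>s. g (C s) (V s) (Z (C s)))
      has_real_derivative (\<Sum>j\<in>UNIV. v $ j * (\<Sum>i\<in>UNIV. u $ i * (G (\<Gamma> i j) (Z ?p) + G (?d j ?p) (Nz i)))
        + V' $ j * G (?d j ?p) (Z ?p))) (at t)"
    unfolding has_field_derivative_def
    by (rule has_derivative_transform_within_open[OF _ S(1,2)]) (simp add: exp[OF _ Zt])
  moreover have "(\<Sum>j\<in>UNIV. v $ j * (\<Sum>i\<in>UNIV. u $ i * (G (\<Gamma> i j) (Z ?p) + G (?d j ?p) (Nz i)))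
        + V' $ j * G (?d j ?p) (Z ?p)) = G D (Z ?p) + (\<Sum>i\<in>UNIV. u $ i * G (V t) (Nz i))"
  proof -
    have "D = (\<Sum>j\<in>UNIV. V' $ j *\<^sub>R ?d j ?p) + (\<Sum>i\<in>UNIV. \<Sum>j\<in>UNIV. (u $ i * v $ j) *\<^sub>R \<Gamma> i j)"
      (is "D = ?a + ?b")
    proof (rule tangent_space_eqI[OF D(1) _ cA])
      show "?a + ?b \<in> tangent_space A ?p"
        using tangent[OF d cA(2)] \<Gamma>t
        by (intro subspace_add subspace_sum subspace_scale subspace_tangent_space)
      have "component ?a c = V'"
        using basis_expansion[of V']
        by (simp add: component_sum component_simps component_coord_field[OF cA]
            jacobian_self[OF cA] scalar_mult_eq_scaleR)
      then show "component D c = component (?a + ?b) c"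
        unfolding D(2) by (simp add: component_sum component_simps v_def \<Gamma>_def)
    qed
    \<comment> \<open>A single sum over pairs, so that linearity over sums is applied once.\<close>
    also have "\<dots> = (\<Sum>j\<in>UNIV. V' $ j *\<^sub>R ?d j ?p) +
        (\<Sum>(i, j)\<in>UNIV. (u $ i * v $ j) *\<^sub>R \<Gamma> i j)"
      by (simp add: sum.cartesian_product)
    finally have "G D (Z ?p) = G ((\<Sum>j\<in>UNIV. V' $ j *\<^sub>R ?d j ?p) +
        (\<Sum>(i, j)\<in>UNIV. (u $ i * v $ j) *\<^sub>R \<Gamma> i j)) (Z ?p)"
      by simp
    also have "\<dots> = G (\<Sum>j\<in>UNIV. V' $ j *\<^sub>R ?d j ?p) (Z ?p) +
        G (\<Sum>k\<in>UNIV. (u $ fst k * v $ snd k) *\<^sub>R \<Gamma> (fst k) (snd k)) (Z ?p)"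
    proof -
      have "(\<Sum>j\<in>UNIV. V' $ j *\<^sub>R ?d j ?p) \<in> tangent_space A ?p"
        using tangent[OF d cA(2)] by (intro subspace_sum subspace_scale subspace_tangent_space)
      moreover have "(\<Sum>k\<in>UNIV. (u $ fst k * v $ snd k) *\<^sub>R \<Gamma> (fst k) (snd k)) \<in> tangent_space A ?p"
        using \<Gamma>t by (intro subspace_sum subspace_scale subspace_tangent_space)
      ultimately show ?thesis
        using metric_linear(2)[OF g Zt] unfolding linear_on_space_def G_def case_prod_unfold by simp
    qed
    also have "\<dots> = (\<Sum>j\<in>UNIV. V' $ j * G (?d j ?p) (Z ?p)) +
        (\<Sum>k\<in>UNIV. u $ fst k * v $ snd k * G (\<Gamma> (fst k) (snd k)) (Z ?p))"
      using lin(2)[OF Zt finite_class.finite_UNIV, of "\<lambda>j. ?d j ?p" ?p "\<lambda>j. V' $ j"]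
        lin(2)[OF Zt finite_class.finite_UNIV, of "\<lambda>k. \<Gamma> (fst k) (snd k)" ?p "\<lambda>k. u $ fst k * v $ snd k"]
        tangent[OF d cA(2)] \<Gamma>t by (simp add: G_def)
    also have "(\<Sum>k\<in>UNIV. u $ fst k * v $ snd k * G (\<Gamma> (fst k) (snd k)) (Z ?p))
        = (\<Sum>i\<in>UNIV. \<Sum>j\<in>UNIV. u $ i * v $ j * G (\<Gamma> i j) (Z ?p))"
      by (simp add: sum.cartesian_product case_prod_unfold)
    finally have GD: "G D (Z ?p) = (\<Sum>j\<in>UNIV. V' $ j * G (?d j ?p) (Z ?p)) +
        (\<Sum>i\<in>UNIV. \<Sum>j\<in>UNIV. u $ i * v $ j * G (\<Gamma> i j) (Z ?p))" .
    have GV: "G (V t) (Nz i) = (\<Sum>j\<in>UNIV. v $ j * G (?d j ?p) (Nz i))" for i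
      using exp[OF S(2) Nt] by (simp add: G_def v_def)
    have "(\<Sum>j\<in>UNIV. v $ j * (\<Sum>i\<in>UNIV. u $ i * (G (\<Gamma> i j) (Z ?p) + G (?d j ?p) (Nz i))))
        = (\<Sum>i\<in>UNIV. \<Sum>j\<in>UNIV. v $ j * (u $ i * (G (\<Gamma> i j) (Z ?p) + G (?d j ?p) (Nz i))))"
      unfolding sum_distrib_left by (rule sum.swap)
    then show ?thesis
      unfolding GD GV
      by (simp add: sum.distrib sum_distrib_left algebra_simps)
  qed
  ultimately show ?thesis
    by (simp add: G_def Nz_def)
qed

section \<open>Almost contact B-metric geometry\<close>

lemma B_metric_pointwise:
  assumes M: "almost_contact_B_metric A \<phi> \<xi> \<eta> g"
  shows "pseudo_riemannian_metric A g"
    and "smooth_vfield A UNIV \<xi>"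
    and "\<xi> p \<in> tangent_space A p"
    and "linear_on_space (tangent_space A p) (\<phi> p)"
    and "linear_on_space (tangent_space A p) (\<eta> p)"
    and "\<eta> p (\<xi> p) = 1"
    and "v \<in> tangent_space A p \<Longrightarrow> \<phi> p v \<in> tangent_space A p"
    and "v \<in> tangent_space A p \<Longrightarrow> \<phi> p (\<phi> p v) = - v + \<eta> p v *\<^sub>R \<xi> p"
    and "\<lbrakk>v \<in> tangent_space A p; w \<in> tangent_space A p\<rbrakk> \<Longrightarrow>
      g p (\<phi> p v) (\<phi> p w) = - g p v w + \<eta> p v * \<eta> p w"
proof -
  note M' = M[unfolded almost_contact_B_metric_def]
  show "pseudo_riemannian_metric A g" and \<xi>: "smooth_vfield A UNIV \<xi>" and "\<eta> p (\<xi> p) = 1"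
    using M' by simp_all
  from \<xi> show "\<xi> p \<in> tangent_space A p"
    by (simp add: smooth_vfield_def)
  have \<phi>: "endomorphism_field A \<phi>" and \<eta>: "one_form A \<eta>"
    using M' by simp_all
  from \<phi> show "linear_on_space (tangent_space A p) (\<phi> p)"
    and "v \<in> tangent_space A p \<Longrightarrow> \<phi> p v \<in> tangent_space A p"
    unfolding endomorphism_field_def by (simp, blast)
  from \<eta> show "linear_on_space (tangent_space A p) (\<eta> p)"
    unfolding one_form_def by simp
  show "v \<in> tangent_space A p \<Longrightarrow> \<phi> p (\<phi> p v) = - v + \<eta> p v *\<^sub>R \<xi> p"
    and "\<lbrakk>v \<in> tangent_space A p; w \<in> tangent_space A p\<rbrakk> \<Longrightarrow>
      g p (\<phi> p v) (\<phi> p w) = - g p v w + \<eta> p v * \<eta> p w"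
    using M' by simp_all
qed

text \<open>
  First \<open>\<phi>\<^sup>2 \<xi> = 0\<close>. Applying \<open>\<phi>\<^sup>2 = - id + \<eta> \<otimes> \<xi>\<close> to \<open>\<phi> \<xi>\<close> then gives \<open>\<phi> \<xi> = a \<xi>\<close>, so \<open>a\<^sup>2 = 0\<close> and
  \<open>\<phi> \<xi> = 0\<close>. Computing \<open>\<phi>\<^sup>3 v\<close> in two ways yields \<open>\<eta> (\<phi> v) = 0\<close>, and the compatibility of \<open>g\<close> with \<open>\<phi>\<close> for
  the pair \<open>v\<close>, \<open>\<xi>\<close> yields \<open>g v \<xi> = \<eta> v\<close>.
\<close>

lemma B_metric_Reeb:
  assumes M: "almost_contact_B_metric A \<phi> \<xi> \<eta> g"
  shows phi_Reeb: "\<phi> p (\<xi> p) = 0"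
    and eta_phi: "v \<in> tangent_space A p \<Longrightarrow> \<eta> p (\<phi> p v) = 0"
    and metric_Reeb: "v \<in> tangent_space A p \<Longrightarrow> g p v (\<xi> p) = \<eta> p v"
proof -
  note B = B_metric_pointwise[OF M]
  note \<phi> = linear_on_spaceD[OF B(4)] and \<eta> = linear_on_spaceD[OF B(5)]
  have T: "\<phi> p v \<in> tangent_space A p" "- v \<in> tangent_space A p" "a *\<^sub>R v \<in> tangent_space A p"
    if "v \<in> tangent_space A p" for v a
    using B(7) subspace_neg[OF subspace_tangent_space] subspace_scale[OF subspace_tangent_space] that
    by blast+
  have Reeb_nonzero: "\<xi> p \<noteq> 0"
  proof
    assume "\<xi> p = 0"
    with \<eta>(3)[OF B(3)] B(6) show False by (metis zero_neq_one)
  qed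
  have "\<phi> p (\<phi> p (\<xi> p)) = 0"
    using B(8)[OF B(3)] B(6) by simp
  then have "- \<phi> p (\<xi> p) + \<eta> p (\<phi> p (\<xi> p)) *\<^sub>R \<xi> p = 0"
    using B(8)[OF T(1)[OF B(3)]] \<phi>(3)[OF B(3)] by simp
  then obtain a where a: "\<phi> p (\<xi> p) = a *\<^sub>R \<xi> p"
    by (metis add.commute add_eq_0_iff minus_minus)
  have "\<phi> p (a *\<^sub>R \<xi> p) = a *\<^sub>R \<phi> p (\<xi> p)"
    by (rule \<phi>(2)[OF B(3)])
  then have "a *\<^sub>R a *\<^sub>R \<xi> p = 0"
    using \<open>\<phi> p (\<phi> p (\<xi> p)) = 0\<close> unfolding a by metis
  with Reeb_nonzero a show \<phi>\<xi>: "\<phi> p (\<xi> p) = 0"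
    by simp
  assume v: "v \<in> tangent_space A p"
  have "\<phi> p (\<phi> p (\<phi> p v)) = - \<phi> p v"
    using B(8)[OF v] \<phi>(1)[OF T(2)[OF v] T(3)[OF B(3)]] \<phi>(4)[OF v] \<phi>(2)[OF B(3)] \<phi>\<xi> by simp
  then show "\<eta> p (\<phi> p v) = 0"
    using B(8)[OF T(1)[OF v]] Reeb_nonzero by simp
  have "g p (\<phi> p v) 0 = 0"
    by (rule linear_on_spaceD(3)[OF metric_linear(1)[OF B(1) T(1)[OF v]] v])
  then show "g p v (\<xi> p) = \<eta> p v"
    using B(9)[OF v B(3)] B(6) \<phi>\<xi> by simp
qed

text \<open>
  If \<open>v\<close> is nonzero, then \<open>v\<close>, \<open>\<phi> v\<close> and \<open>\<xi>\<close> are linearly independent and so span the tangent space;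
  as \<open>v\<close> is orthogonal to all of them, \<open>g\<close> would be degenerate. The dimension count is carried out on
  components in a chart, where an injective linear endomorphism of \<open>\<real>\<^sup>3\<close> is surjective.
\<close>

lemma isotropic_contact_plane_vector_zero:
  assumes M: "almost_contact_B_metric A \<phi> \<xi> \<eta> g"
    and v: "v \<in> tangent_space A p" and \<eta>v: "\<eta> p v = 0"
    and gv: "g p v v = 0" "g p v (\<phi> p v) = 0"
  shows "v = 0"
proof (rule ccontr)
  assume nz: "v \<noteq> 0"
  note B = B_metric_pointwise[OF M]
  note \<phi> = linear_on_spaceD[OF B(4)] and \<eta> = linear_on_spaceD[OF B(5)]
  note T = subspace_add[OF subspace_tangent_space] subspace_scale[OF subspace_tangent_space]
    subspace_0[OF subspace_tangent_space]
  define c where "c = chart_at A p"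
  have c: "c \<in> A" "p \<in> fst c"
    using chart_at[OF manifold] by (simp_all add: c_def)
  define E where "E y = (y $ 1 *\<^sub>R v + y $ 2 *\<^sub>R \<phi> p v) + y $ 3 *\<^sub>R \<xi> p" for y :: "real^3"
  define L where "L y = component (E y) c" for y
  have ET: "E y \<in> tangent_space A p" for y
    unfolding E_def by (intro T v B(7) B(3))
  have "linear L"
    by (rule linearI) (simp_all add: L_def E_def component_simps algebra_simps)
  moreover have "inj L"
    unfolding linear_injective_0[OF \<open>linear L\<close>]
  proof (intro allI impI)
    fix y assume "L y = 0"
    then have E0: "E y = 0"
      by (intro tangent_space_eqI[OF ET T(3) c]) (simp add: L_def component_simps)
    have "\<eta> p (E y) = y $ 3"
      unfolding E_def
      by (simp add: \<eta>(1,2) T v B(3,6,7) \<eta>v eta_phi[OF M])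
    then have y3: "y $ 3 = 0"
      using E0 \<eta>(3)[OF v] by simp
    have "\<phi> p (E y) = y $ 1 *\<^sub>R \<phi> p v - y $ 2 *\<^sub>R v"
      unfolding E_def
      by (simp add: \<phi>(1,2) T v B(3,7) B(8)[OF v] \<eta>v phi_Reeb[OF M])
    then have e1: "y $ 1 *\<^sub>R \<phi> p v = y $ 2 *\<^sub>R v"
      using E0 \<phi>(3)[OF v] by simp
    have e2: "y $ 1 *\<^sub>R v + y $ 2 *\<^sub>R \<phi> p v = 0"
      using E0 y3 by (simp add: E_def)
    \<comment> \<open>Eliminating \<open>\<phi> v\<close> leaves the determinant of the system, which is a sum of squares
      because \<open>\<phi>\<close> acts as a complex structure.\<close>
    have "(y $ 1 * y $ 1 + y $ 2 * y $ 2) *\<^sub>R v = y $ 1 *\<^sub>R (y $ 1 *\<^sub>R v + y $ 2 *\<^sub>R \<phi> p v)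
        - y $ 2 *\<^sub>R (y $ 1 *\<^sub>R \<phi> p v - y $ 2 *\<^sub>R v)"
      by (simp add: algebra_simps)
    then have "y $ 1 * y $ 1 + y $ 2 * y $ 2 = 0"
      using e1 e2 nz by simp
    with y3 show "y = 0"
      by (simp add: vec_eq_iff forall_3 sum_squares_eq_zero_iff)
  qed
  ultimately have surj: "surj L"
    by (rule linear_injective_imp_surjective) simp
  have "g p v w = 0" if w: "w \<in> tangent_space A p" for w
  proof -
    obtain y where "component w c = L y"
      using surj by blast
    then have "w = E y"
      by (intro tangent_space_eqI[OF w ET c]) (simp add: L_def)
    then show ?thesis
      unfolding E_def
      using metric_Reeb[OF M v] gv \<eta>v
      by (simp add: linear_on_spaceD(1,2)[OF metric_linear(1)[OF B(1) v]] T v B(3,7))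
  qed
  with B(1) v nz show False
    unfolding pseudo_riemannian_metric_def by blast
qed

text \<open>
  Since \<open>\<phi> \<xi> = 0\<close>, the Sasaki-like condition for \<open>Y = \<xi>\<close> reads \<open>\<phi> (\<nabla>\<^sub>X \<xi>) = X - \<eta>(X) \<xi>\<close>. Applying \<open>\<phi>\<close> once more
  determines \<open>\<nabla>\<^sub>X \<xi>\<close> modulo \<open>\<xi>\<close>. The multiple of \<open>\<xi>\<close> is left open because its product with vectors of
  \<open>ker \<eta>\<close> is zero.
\<close>

lemma sasaki_like_nabla_Reeb:
  assumes M: "almost_contact_B_metric A \<phi> \<xi> \<eta> g" and lc: "levi_civita A g nabla"
    and S: "sasaki_like A \<phi> \<xi> \<eta> g nabla"
    and U: "open U" "p \<in> U" and X: "smooth_vfield A U X"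
  obtains a where "nabla X \<xi> p = - \<phi> p (X p) + a *\<^sub>R \<xi> p"
proof -
  note B = B_metric_pointwise[OF M]
  note \<phi> = linear_on_spaceD[OF B(4)]
  have \<xi>: "smooth_vfield A U \<xi>"
    by (rule smooth_vfield_subset[OF B(2)]) simp
  have Xp: "X p \<in> tangent_space A p" and N: "nabla X \<xi> p \<in> tangent_space A p"
    using X smooth_nabla[OF lc U(1) X \<xi>] U(2) by (simp_all add: smooth_vfield_def)
  \<comment> \<open>The zero field is smooth because it is \<open>\<phi> \<xi>\<close>.\<close>
  have zero: "smooth_vfield A U (\<lambda>q. 0)"
  proof -
    have "smooth_vfield A U (\<lambda>q. \<phi> q (\<xi> q))"
      using M[unfolded almost_contact_B_metric_def, THEN conjunct2, THEN conjunct1,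
          unfolded endomorphism_field_def, THEN conjunct2] U(1) \<xi> by blast
    then show ?thesis
      by (simp add: phi_Reeb[OF M])
  qed
  have "nabla X (\<lambda>q. 0) p = 0"
    using nabla_add[OF lc U(1) X zero zero U(2)] by simp
  moreover have "nabla X (\<lambda>q. \<phi> q (\<xi> q)) p - \<phi> p (nabla X \<xi> p)
      = - (g p (X p) (\<xi> p) *\<^sub>R \<xi> p) - \<eta> p (\<xi> p) *\<^sub>R X p
      + (2 * \<eta> p (X p) * \<eta> p (\<xi> p)) *\<^sub>R \<xi> p"
    by (rule S[unfolded sasaki_like_def, rule_format, of U X \<xi> p]) (simp_all add: U X \<xi>)
  ultimately have "- \<phi> p (nabla X \<xi> p) = - (g p (X p) (\<xi> p) *\<^sub>R \<xi> p) - \<eta> p (\<xi> p) *\<^sub>R X p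
      + (2 * \<eta> p (X p) * \<eta> p (\<xi> p)) *\<^sub>R \<xi> p"
    by (simp only: phi_Reeb[OF M] diff_0)
  also have "\<dots> = - (X p + (- \<eta> p (X p)) *\<^sub>R \<xi> p)"
    unfolding metric_Reeb[OF M Xp] B(6) mult_2 distrib_right scaleR_add_left by simp
  finally have "\<phi> p (nabla X \<xi> p) = X p + (- \<eta> p (X p)) *\<^sub>R \<xi> p"
    unfolding neg_equal_iff_equal .
  then have "\<phi> p (\<phi> p (nabla X \<xi> p)) = \<phi> p (X p + (- \<eta> p (X p)) *\<^sub>R \<xi> p)"
    by (rule arg_cong[where f = "\<phi> p"])
  also have "\<dots> = \<phi> p (X p)"
    unfolding \<phi>(1)[OF Xp subspace_scale[OF subspace_tangent_space B(3)]] \<phi>(2)[OF B(3)] phi_Reeb[OF M]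
    by simp
  finally have \<phi>X: "\<phi> p (X p) = - nabla X \<xi> p + \<eta> p (nabla X \<xi> p) *\<^sub>R \<xi> p"
    unfolding B(8)[OF N] by (rule sym)
  have "nabla X \<xi> p = - \<phi> p (X p) + \<eta> p (nabla X \<xi> p) *\<^sub>R \<xi> p"
    unfolding \<phi>X by simp
  then show thesis
    by (rule that)
qed

text \<open>
  The function \<open>g(V, \<xi>) = \<eta>(V)\<close> is constantly zero near \<open>t\<close>; the product rule evaluates its derivative
  to \<open>- g(V, \<phi> V)\<close>.
\<close>

lemma legendre_geodesic_phi_orthogonal:
  assumes M: "almost_contact_B_metric A \<phi> \<xi> \<eta> g" and lc: "levi_civita A g nabla"
    and SL: "sasaki_like A \<phi> \<xi> \<eta> g nabla"
    and C: "smooth_curve A I C" "legendre_curve A \<eta> I C" "geodesic_curve A nabla I C"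
    and t: "t \<in> interior I"
  shows "g (C t) (velocity A I C t) (\<phi> (C t) (velocity A I C t)) = 0"
proof -
  note B = B_metric_pointwise[OF M]
  define c where "c = chart_at A (C t)"
  have c: "c \<in> A" "C t \<in> fst c"
    using chart_at[OF manifold] by (simp_all add: c_def)
  define S where "S = interior I \<inter> C -` fst c"
  have tS: "t \<in> S"
    using t c by (simp add: S_def)
  define V where "V = velocity A I C"
  define d where "d i = coord_field A c i (C t)" for i
  obtain \<gamma>2 where oS: "open S"
    and C1: "\<And>s. s \<in> S \<Longrightarrow> ((snd c \<circ> C) has_vector_derivative component (V s) c) (at s)"
    and C2: "\<And>s. s \<in> S \<Longrightarrow> ((\<lambda>s. component (V s) c) has_vector_derivative \<gamma>2 s) (at s)"
    using curve_in_chart[OF C(1) c(1)] unfolding S_def V_def by metis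
  have SI: "s \<in> interior I" "s \<in> I" "C s \<in> fst c" if "s \<in> S" for s
    using that interior_subset unfolding S_def by auto
  have VT: "V s \<in> tangent_space A (C s)" if "s \<in> S" for s
    unfolding V_def by (rule velocity_tangent[OF C(1) SI(1)[OF that]])
  have \<eta>V: "\<eta> (C s) (V s) = 0" if "s \<in> S" for s
    using C(2) SI(2)[OF that] by (simp add: legendre_curve_def V_def)
  obtain h where h: "acceleration A nabla I C t = h *\<^sub>R V t"
    using C(3) SI(2)[OF tS] unfolding geodesic_curve_def V_def by blast
  have "vector_derivative (\<lambda>s. component (V s) c) (at t within I) = \<gamma>2 t"
    unfolding at_within_interior[OF t] by (rule vector_derivative_at[OF C2[OF tS]])
  then have "component (acceleration A nabla I C t) c = \<gamma>2 t + (\<Sum>i\<in>UNIV. \<Sum>j\<in>UNIV.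
      (component (V t) c $ i * component (V t) c $ j) *\<^sub>R
        component (nabla (coord_field A c i) (coord_field A c j) (C t)) c)"
    unfolding covariant_deriv_along_def component_Tvec V_def using c by (simp only: if_True simp_thms)
  note acc = this[unfolded h]
  have hT: "h *\<^sub>R V t \<in> tangent_space A (C t)"
    by (rule subspace_scale[OF subspace_tangent_space VT[OF tS]])
  have "((\<lambda>s. g (C s) (V s) (\<xi> (C s))) has_real_derivative
      g (C t) (h *\<^sub>R V t) (\<xi> (C t)) + (\<Sum>i\<in>UNIV. component (V t) c $ i *
        g (C t) (V t) (nabla (coord_field A c i) \<xi> (C t)))) (at t)"
    by (rule metric_product_rule_along_curve[OF B(1) lc B(2) c_def C1[OF tS] oS tS SI(3) VT C2[OF tS] hT acc])
  moreover have "((\<lambda>s. g (C s) (V s) (\<xi> (C s))) has_real_derivative 0) (at t)"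
    using DERIV_const[of 0 "at t"] unfolding has_field_derivative_def
    by (rule has_derivative_transform_within_open[OF _ oS tS]) (simp add: metric_Reeb[OF M VT] \<eta>V)
  ultimately have "g (C t) (h *\<^sub>R V t) (\<xi> (C t)) + (\<Sum>i\<in>UNIV. component (V t) c $ i *
        g (C t) (V t) (nabla (coord_field A c i) \<xi> (C t))) = 0"
    by (rule DERIV_unique)
  moreover have "g (C t) (h *\<^sub>R V t) (\<xi> (C t)) = 0"
    using linear_on_spaceD(2)[OF metric_linear(2)[OF B(1,3)] VT[OF tS]]
      metric_Reeb[OF M VT[OF tS]] \<eta>V[OF tS] by simp
  ultimately have sum0: "(\<Sum>i\<in>UNIV. component (V t) c $ i *
        g (C t) (V t) (nabla (coord_field A c i) \<xi> (C t))) = 0"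
    by linarith
  have dT: "d i \<in> tangent_space A (C t)" for i
    unfolding d_def by (rule coord_field_tangent[OF c])
  note G = linear_on_spaceD[OF metric_linear(1)[OF B(1) VT[OF tS]]]
  have G\<xi>: "g (C t) (V t) (nabla (coord_field A c i) \<xi> (C t)) = - g (C t) (V t) (\<phi> (C t) (d i))" for i
  proof -
    obtain a where a: "nabla (coord_field A c i) \<xi> (C t) = - \<phi> (C t) (d i) + a *\<^sub>R \<xi> (C t)"
      using sasaki_like_nabla_Reeb[OF M lc SL smooth_manifold3D(2)[OF manifold c(1)] c(2)
          smooth_coord_field[OF c(1)]] unfolding d_def by metis
    show ?thesis
      unfolding a
      using G(1)[OF subspace_neg[OF subspace_tangent_space B(7)[OF dT]]
          subspace_scale[OF subspace_tangent_space B(3)]]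
        G(4)[OF B(7)[OF dT]] G(2)[OF B(3)] metric_Reeb[OF M VT[OF tS]] \<eta>V[OF tS] by simp
  qed
  have sum0': "(\<Sum>i\<in>UNIV. component (V t) c $ i * g (C t) (V t) (\<phi> (C t) (d i))) = 0"
    using sum0 unfolding G\<xi> mult_minus_right sum_negf neg_equal_0_iff_equal .
  have "\<phi> (C t) (V t) = \<phi> (C t) (\<Sum>i\<in>UNIV. component (V t) c $ i *\<^sub>R d i)"
    unfolding d_def by (rule arg_cong[OF coord_field_expansion[OF c VT[OF tS]]])
  also have "\<dots> = (\<Sum>i\<in>UNIV. component (V t) c $ i *\<^sub>R \<phi> (C t) (d i))"
    by (rule linear_on_space_sum[OF subspace_tangent_space B(4) finite_class.finite_UNIV dT])
  finally have "g (C t) (V t) (\<phi> (C t) (V t))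
      = g (C t) (V t) (\<Sum>i\<in>UNIV. component (V t) c $ i *\<^sub>R \<phi> (C t) (d i))"
    by (rule arg_cong)
  also have "\<dots> = (\<Sum>i\<in>UNIV. component (V t) c $ i *\<^sub>R g (C t) (V t) (\<phi> (C t) (d i)))"
    by (rule linear_on_space_sum[OF subspace_tangent_space metric_linear(1)[OF B(1) VT[OF tS]]
          finite_class.finite_UNIV B(7)[OF dT]])
  finally show ?thesis
    unfolding V_def[symmetric] real_scaleR_def sum0' .
qed

end

theorem proposition4p2:
  fixes A :: "'p::{t2_space,second_countable_topology} chart set"
    and \<phi> :: "'p \<Rightarrow> 'p tvec \<Rightarrow> 'p tvec"
    and \<xi> :: "'p vfield"
    and \<eta> :: "'p \<Rightarrow> 'p tvec \<Rightarrow> real"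
    and g :: "'p \<Rightarrow> 'p tvec \<Rightarrow> 'p tvec \<Rightarrow> real"
    and nabla :: "'p vfield \<Rightarrow> 'p vfield \<Rightarrow> 'p vfield"
  assumes "almost_contact_B_metric A \<phi> \<xi> \<eta> g"
    and "levi_civita A g nabla"
    and "sasaki_like A \<phi> \<xi> \<eta> g nabla"
  shows "\<not> (\<exists>(I :: real set) (C :: real \<Rightarrow> 'p).
           null_curve A g I C \<and> legendre_curve A \<eta> I C \<and> geodesic_curve A nabla I C)"
proof
  interpret smooth_3manifold A
    using assms(1) by unfold_locales (simp add: almost_contact_B_metric_def)
  assume "\<exists>I C. null_curve A g I C \<and> legendre_curve A \<eta> I C \<and> geodesic_curve A nabla I C"
  then obtain I :: "real set" and C :: "real \<Rightarrow> 'p" where null: "null_curve A g I C"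
    and C: "legendre_curve A \<eta> I C" "geodesic_curve A nabla I C"
    by blast
  have smooth: "smooth_curve A I C"
    using null by (simp add: null_curve_def)
  then obtain t where t: "t \<in> interior I"
    unfolding smooth_curve_def by blast
  then have tI: "t \<in> I"
    using interior_subset by blast
  have "velocity A I C t = 0"
  proof (rule isotropic_contact_plane_vector_zero[OF assms(1) velocity_tangent[OF smooth t]])
    show "\<eta> (C t) (velocity A I C t) = 0"
      using C(1) tI by (simp add: legendre_curve_def)
    show "g (C t) (velocity A I C t) (velocity A I C t) = 0"
      using null tI by (simp add: null_curve_def)
    show "g (C t) (velocity A I C t) (\<phi> (C t) (velocity A I C t)) = 0"
      by (rule legendre_geodesic_phi_orthogonal[OF assms smooth C t])
  qed
  with null tI show False
    by (simp add: null_curve_def)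
qed

end
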